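(* For every space bound $s(n)\in o(\log n)$, QTM-WOMs are strictly superior to PTM-WOMs in terms of language recognition with positive one-sided bounded error in space $s$. That is, every language recognized with positive one-sided bounded error by an $s(n)$-space PTM-WOM is recognized with positive one-sided bounded error by an $s(n)$-space QTM-WOM, and there is a language recognized with positive one-sided bounded error by an $s(n)$-space QTM-WOM but not by any $s(n)$-space PTM-WOM.
   Context: A PTM is a standard probabilistic Turing machine with a two-way read-only input tape (containing ¢$w$\$ for input $w\in\Sigma^*$) and one two-way read/write work tape. A PTM-WOM additionally has a write-only memory (WOM): a two-way tape with finite alphabet $\Gamma$ containing the blank symbol and the empty symbol $\varepsilon$, whose content is never read. In each step the machine writes a symbol of $\Gamma$ on the square under the WOM head (writing $\varepsilon$ leaves the square unchanged) and moves the WOM head left, right, or not at all, the transition not depending on the WOM content. A QTM-WOM has the same components (finite state set, two-way read-only input tape, read/write work tape, WOM tape) together with a finite register with alphabet $\Omega$ partitioned into "accept", "reject" and "continue" symbols. Depending on the state and the scanned input and work tape symbols, in one step it changes state, writes on the work tape, moves the input and work heads, writes on the WOM and moves the WOM head, and writes $\omega\in\Omega$ in the register, with a given transition amplitude in $\mathbb C$ (amplitudes are efficiently computable numbers). A configuration consists of the state, the head positions and the contents of the work and WOM tapes (not the register). With $E_\omega$ the matrix of one-step amplitudes between configurations with $\omega$ written in the register, the machine must be well-formed: $\sum_{\omega\in\Omega}E_\omega^\dagger E_\omega=I$. After each step the register is observed. The machine halts and accepts (rejects) if an accept (reject) symbol is seen; otherwise the register is reset to its initial symbol and the computation continues. Space: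 a machine uses space $s(n)$ if, on every input of length $n$ and every computation path, at most $s(n)$ squares of the read/write work tape are used. The WOM is not counted. Recognition: with $f_{\mathcal M}(w)$ the probability that $\mathcal M$ accepts $w$, $L\subseteq\Sigma^*$ is recognized by $\mathcal M$ with positive one-sided bounded error if there is $p\in(0,1]$ such that $f_{\mathcal M}(w)\ge p$ for $w\in L$ and $f_{\mathcal M}(w)=0$ for $w\notin L$. *)

theory Defs
  imports "HOL-Analysis.Analysis" "HOL-Library.Landau_Symbols"
begin

datatype move = MoveLeft | Stay | MoveRight

fun shift :: "move \<Rightarrow> int \<Rightarrow> int" where
  "shift MoveLeft i = i - 1"
| "shift Stay i = i"
| "shift MoveRight i = i + 1"


section \<open>Efficiently computable numbers\<close>

text \<open>
  A real is efficiently computable if a deterministic Turing machine, given \<open>n\<close> in unary,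
  produces in time polynomial in \<open>n\<close> a binary fixed-point number within \<open>2 ^ (-n)\<close> of it.
  The machine has one two-way work tape, which initially holds the input, and appends its output
  to a one-way output tape; it halts when no transition is defined.
\<close>

datatype outsym = Minus | Point | Bit bool

record transducer =
  tstates :: "nat set"
  tstart :: nat
  talph :: "nat set"
  tblank :: nat
  tmark :: nat
  tdelta :: "nat \<Rightarrow> nat \<Rightarrow> (nat \<times> nat \<times> move \<times> outsym option) option"

definition transducer_ok :: "transducer \<Rightarrow> bool" where
  "transducer_ok T \<longleftrightarrow>
     finite (tstates T) \<and> tstart T \<in> tstates T \<and>
     finite (talph T) \<and> tblank T \<in> talph T \<and> tmark T \<in> talph T \<and> tblank T \<noteq> tmark T \<and>
     (\<forall>q\<in>tstates T. \<forall>a\<in>talph T. \<forall>q' a' m out.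
        tdelta T q a = Some (q', a', m, out) \<longrightarrow> q' \<in> tstates T \<and> a' \<in> talph T)"

type_synonym tconfig = "nat \<times> int \<times> (int \<Rightarrow> nat) \<times> outsym list"

definition tinit :: "transducer \<Rightarrow> nat \<Rightarrow> tconfig" where
  "tinit T n = (tstart T, 0, (\<lambda>i. if 0 \<le> i \<and> i < int n then tmark T else tblank T), [])"

fun tstep :: "transducer \<Rightarrow> tconfig \<Rightarrow> tconfig" where
  "tstep T (q, i, t, out) =
     (case tdelta T q (t i) of
        None \<Rightarrow> (q, i, t, out)
      | Some (q', a, m, x) \<Rightarrow>
          (q', shift m i, t(i := a), (case x of None \<Rightarrow> out | Some y \<Rightarrow> out @ [y])))"

fun thalted :: "transducer \<Rightarrow> tconfig \<Rightarrow> bool" where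
  "thalted T (q, i, t, out) \<longleftrightarrow> tdelta T q (t i) = None"

fun toutput :: "tconfig \<Rightarrow> outsym list" where
  "toutput (q, i, t, out) = out"

definition fixed_point_code :: "bool \<Rightarrow> bool list \<Rightarrow> bool list \<Rightarrow> outsym list" where
  "fixed_point_code neg xs ys =
     (if neg then [Minus] else []) @ map Bit xs @ [Point] @ map Bit ys"

definition fixed_point_value :: "bool \<Rightarrow> bool list \<Rightarrow> bool list \<Rightarrow> real" where
  "fixed_point_value neg xs ys =
     (if neg then -1 else 1) *
     ((\<Sum>j<length xs. of_bool (xs ! j) * 2 ^ (length xs - 1 - j)) +
      (\<Sum>j<length ys. of_bool (ys ! j) / 2 ^ (j + 1)))"

definition efficiently_computable_real :: "real \<Rightarrow> bool" where
  "efficiently_computable_real x \<longleftrightarrow>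
     (\<exists>T k. transducer_ok T \<and>
        (\<forall>n. let c = (tstep T ^^ (n ^ k + k)) (tinit T n) in
           thalted T c \<and>
           (\<exists>neg xs ys. toutput c = fixed_point_code neg xs ys \<and>
              \<bar>fixed_point_value neg xs ys - x\<bar> \<le> 1 / 2 ^ n)))"

definition efficiently_computable :: "complex \<Rightarrow> bool" where
  "efficiently_computable z \<longleftrightarrow>
     efficiently_computable_real (Re z) \<and> efficiently_computable_real (Im z)"


section \<open>Machines with a write-only memory\<close>

text \<open>
  States and symbols are natural numbers, each machine having its own finite sets of them.
  The input tape holds \<open>w\<close> on the squares \<open>1, \<dots>, length w\<close>, between the two end-markers;
  the work tape and the WOM tape are infinite in both directions.
\<close>

datatype insym = LeftEnd | RightEnd | Letter nat

definition insyms :: "nat set \<Rightarrow> insym set" where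
  "insyms \<Sigma> = {LeftEnd, RightEnd} \<union> Letter ` \<Sigma>"

definition input_at :: "nat list \<Rightarrow> int \<Rightarrow> insym" where
  "input_at w i =
     (if i \<le> 0 then LeftEnd
      else if i > int (length w) then RightEnd
      else Letter (w ! nat (i - 1)))"

record wom_frame =
  states :: "nat set"
  start :: nat
  work_alph :: "nat set"
  work_blank :: nat
  wom_alph :: "nat set"
  wom_blank :: nat
  wom_empty :: nat

definition frame_ok :: "('m) wom_frame_scheme \<Rightarrow> bool" where
  "frame_ok M \<longleftrightarrow>
     finite (states M) \<and> start M \<in> states M \<and>
     finite (work_alph M) \<and> work_blank M \<in> work_alph M \<and>
     finite (wom_alph M) \<and> wom_blank M \<in> wom_alph M \<and> wom_empty M \<in> wom_alph M \<and>
     wom_blank M \<noteq> wom_empty M"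

datatype action = Action
  (new_state: nat) (work_write: nat) (input_move: move) (work_move: move)
  (wom_write: nat) (wom_move: move)

definition actions :: "('m) wom_frame_scheme \<Rightarrow> action set" where
  "actions M = {a. new_state a \<in> states M \<and> work_write a \<in> work_alph M \<and>
                   wom_write a \<in> wom_alph M}"

text \<open>The input head never leaves the part of the input tape delimited by the end-markers.\<close>

definition respects_ends :: "insym \<Rightarrow> action \<Rightarrow> bool" where
  "respects_ends \<sigma> a \<longleftrightarrow>
     \<not> (\<sigma> = LeftEnd \<and> input_move a = MoveLeft) \<and>
     \<not> (\<sigma> = RightEnd \<and> input_move a = MoveRight)"

record config =
  state :: nat
  input_pos :: int
  work_pos :: int
  work_tape :: "int \<Rightarrow> nat"
  wom_pos :: int
  wom_tape :: "int \<Rightarrow> nat"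

definition configs :: "('m) wom_frame_scheme \<Rightarrow> nat list \<Rightarrow> config set" where
  "configs M w = {c. state c \<in> states M \<and>
     0 \<le> input_pos c \<and> input_pos c \<le> int (length w) + 1 \<and>
     range (work_tape c) \<subseteq> work_alph M \<and> finite {i. work_tape c i \<noteq> work_blank M} \<and>
     range (wom_tape c) \<subseteq> wom_alph M - {wom_empty M} \<and> finite {i. wom_tape c i \<noteq> wom_blank M}}"

definition init_config :: "('m) wom_frame_scheme \<Rightarrow> config" where
  "init_config M =
     \<lparr> state = start M, input_pos = 0,
       work_pos = 0, work_tape = (\<lambda>_. work_blank M),
       wom_pos = 0, wom_tape = (\<lambda>_. wom_blank M) \<rparr>"

definition perform :: "('m) wom_frame_scheme \<Rightarrow> action \<Rightarrow> config \<Rightarrow> config" where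
  "perform M a c =
     \<lparr> state = new_state a,
       input_pos = shift (input_move a) (input_pos c),
       work_pos = shift (work_move a) (work_pos c),
       work_tape = (work_tape c)(work_pos c := work_write a),
       wom_pos = shift (wom_move a) (wom_pos c),
       wom_tape = (if wom_write a = wom_empty M then wom_tape c
                   else (wom_tape c)(wom_pos c := wom_write a)) \<rparr>"

definition scanned_input :: "nat list \<Rightarrow> config \<Rightarrow> insym" where
  "scanned_input w c = input_at w (input_pos c)"

definition scanned_work :: "config \<Rightarrow> nat" where
  "scanned_work c = work_tape c (work_pos c)"

text \<open>
  A space bound \<open>s\<close> stands for \<open>max 1 (s n)\<close>, since the square initially scanned
  is always used.
\<close>

definition within_space :: "(nat \<Rightarrow> real) \<Rightarrow> nat list \<Rightarrow> config list \<Rightarrow> bool" where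
  "within_space s w cs \<longleftrightarrow> real (card (work_pos ` set cs)) \<le> max 1 (s (length w))"

definition recognizes_pos_one_sided ::
    "nat set \<Rightarrow> (nat list \<Rightarrow> real) \<Rightarrow> nat list set \<Rightarrow> bool" where
  "recognizes_pos_one_sided \<Sigma> f L \<longleftrightarrow>
     (\<exists>p. 0 < p \<and> p \<le> 1 \<and>
        (\<forall>w\<in>lists \<Sigma>. (w \<in> L \<longrightarrow> f w \<ge> p) \<and> (w \<notin> L \<longrightarrow> f w = 0)))"


subsection \<open>Probabilistic machines\<close>

text \<open>In each step a fair coin is tossed, and its outcome selects the transition.\<close>

record ptm_wom = wom_frame +
  accept_state :: nat
  reject_state :: nat
  transition :: "bool \<Rightarrow> nat \<Rightarrow> insym \<Rightarrow> nat \<Rightarrow> action"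

definition ptm_wom_ok :: "nat set \<Rightarrow> ptm_wom \<Rightarrow> bool" where
  "ptm_wom_ok \<Sigma> M \<longleftrightarrow>
     frame_ok M \<and>
     accept_state M \<in> states M \<and> reject_state M \<in> states M \<and>
     accept_state M \<noteq> reject_state M \<and>
     (\<forall>b. \<forall>q\<in>states M. \<forall>\<sigma>\<in>insyms \<Sigma>. \<forall>\<gamma>\<in>work_alph M.
        transition M b q \<sigma> \<gamma> \<in> actions M \<and> respects_ends \<sigma> (transition M b q \<sigma> \<gamma>))"

definition ptm_next :: "ptm_wom \<Rightarrow> nat list \<Rightarrow> bool \<Rightarrow> config \<Rightarrow> config" where
  "ptm_next M w b c =
     perform M (transition M b (state c) (scanned_input w c) (scanned_work c)) c"

text \<open>Probability of accepting within \<open>t\<close> steps, starting from configuration \<open>c\<close>.\<close>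

fun ptm_accept_within :: "ptm_wom \<Rightarrow> nat list \<Rightarrow> nat \<Rightarrow> config \<Rightarrow> real" where
  "ptm_accept_within M w 0 c = (if state c = accept_state M then 1 else 0)"
| "ptm_accept_within M w (Suc t) c =
     (if state c = accept_state M then 1
      else if state c = reject_state M then 0
      else (ptm_accept_within M w t (ptm_next M w False c) +
            ptm_accept_within M w t (ptm_next M w True c)) / 2)"

definition ptm_accept_prob :: "ptm_wom \<Rightarrow> nat list \<Rightarrow> real" where
  "ptm_accept_prob M w = (SUP t. ptm_accept_within M w t (init_config M))"

text \<open>Finite computation paths, most recent configuration first.\<close>

inductive ptm_path :: "ptm_wom \<Rightarrow> nat list \<Rightarrow> config list \<Rightarrow> bool" for M w where
  ptm_path_init: "ptm_path M w [init_config M]"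
| ptm_path_step:
    "ptm_path M w (c # cs) \<Longrightarrow> state c \<notin> {accept_state M, reject_state M} \<Longrightarrow>
     ptm_path M w (ptm_next M w b c # c # cs)"

definition ptm_uses_space :: "nat set \<Rightarrow> (nat \<Rightarrow> real) \<Rightarrow> ptm_wom \<Rightarrow> bool" where
  "ptm_uses_space \<Sigma> s M \<longleftrightarrow>
     (\<forall>w\<in>lists \<Sigma>. \<forall>cs. ptm_path M w cs \<longrightarrow> within_space s w cs)"

definition PTM_WOM_pos_one_sided :: "(nat \<Rightarrow> real) \<Rightarrow> nat set \<Rightarrow> nat list set set" where
  "PTM_WOM_pos_one_sided s \<Sigma> =
     {L. L \<subseteq> lists \<Sigma> \<and>
         (\<exists>M. ptm_wom_ok \<Sigma> M \<and> ptm_uses_space \<Sigma> s M \<and>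
              recognizes_pos_one_sided \<Sigma> (ptm_accept_prob M) L)}"


subsection \<open>Quantum machines\<close>

text \<open>
  \<open>amplitude M q \<sigma> \<gamma> a \<omega>\<close> is the amplitude of performing \<open>a\<close> and writing \<open>\<omega>\<close> in the
  register, in state \<open>q\<close> and scanning \<open>\<sigma>\<close> and \<open>\<gamma>\<close>.  Since the register holds its initial symbol
  at the beginning of each step, neither it nor that symbol occurs in the model.
\<close>

record qtm_wom = wom_frame +
  accept_syms :: "nat set"
  reject_syms :: "nat set"
  continue_syms :: "nat set"
  amplitude :: "nat \<Rightarrow> insym \<Rightarrow> nat \<Rightarrow> action \<Rightarrow> nat \<Rightarrow> complex"

definition register_syms :: "qtm_wom \<Rightarrow> nat set" where
  "register_syms M = accept_syms M \<union> reject_syms M \<union> continue_syms M"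

text \<open>
  The entry of \<open>E\<^sub>\<omega>\<close> leading from \<open>c\<close> to \<open>d\<close>.  Several actions may lead from \<open>c\<close> to \<open>d\<close>: writing
  the empty symbol has the same effect as rewriting the symbol under the WOM head.
\<close>

definition step_amp :: "qtm_wom \<Rightarrow> nat list \<Rightarrow> nat \<Rightarrow> config \<Rightarrow> config \<Rightarrow> complex" where
  "step_amp M w \<omega> d c =
     (\<Sum>a | a \<in> actions M \<and> perform M a c = d.
        amplitude M (state c) (scanned_input w c) (scanned_work c) a \<omega>)"

text \<open>The condition that the sum of all \<open>E\<^sub>\<omega>\<^sup>\<dagger> E\<^sub>\<omega>\<close> is the identity, entry by entry.\<close>

definition well_formed :: "nat set \<Rightarrow> qtm_wom \<Rightarrow> bool" where
  "well_formed \<Sigma> M \<longleftrightarrow>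
     (\<forall>w\<in>lists \<Sigma>. \<forall>c\<in>configs M w. \<forall>c'\<in>configs M w.
        (\<Sum>\<omega>\<in>register_syms M.
           \<Sum>\<^sub>\<infinity>d\<in>configs M w. cnj (step_amp M w \<omega> d c) * step_amp M w \<omega> d c')
        = (if c = c' then 1 else 0))"

definition qtm_wom_ok :: "nat set \<Rightarrow> qtm_wom \<Rightarrow> bool" where
  "qtm_wom_ok \<Sigma> M \<longleftrightarrow>
     frame_ok M \<and>
     finite (register_syms M) \<and>
     accept_syms M \<inter> reject_syms M = {} \<and>
     accept_syms M \<inter> continue_syms M = {} \<and>
     reject_syms M \<inter> continue_syms M = {} \<and>
     (\<forall>q\<in>states M. \<forall>\<sigma>\<in>insyms \<Sigma>. \<forall>\<gamma>\<in>work_alph M. \<forall>a\<in>actions M. \<forall>\<omega>\<in>register_syms M.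
        efficiently_computable (amplitude M q \<sigma> \<gamma> a \<omega>) \<and>
        (amplitude M q \<sigma> \<gamma> a \<omega> \<noteq> 0 \<longrightarrow> respects_ends \<sigma> a)) \<and>
     well_formed \<Sigma> M"

text \<open>
  The unnormalized state after the sequence of register observations \<open>h\<close>, most recent one first;
  its squared norm is the probability of observing that sequence.
\<close>

fun qtm_state :: "qtm_wom \<Rightarrow> nat list \<Rightarrow> nat list \<Rightarrow> config \<Rightarrow> complex" where
  "qtm_state M w [] d = (if d = init_config M then 1 else 0)"
| "qtm_state M w (\<omega> # h) d =
     (\<Sum>\<^sub>\<infinity>c\<in>configs M w. step_amp M w \<omega> d c * qtm_state M w h c)"

definition history_prob :: "qtm_wom \<Rightarrow> nat list \<Rightarrow> nat list \<Rightarrow> real" where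
  "history_prob M w h = (\<Sum>\<^sub>\<infinity>d\<in>configs M w. (cmod (qtm_state M w h d))\<^sup>2)"

text \<open>The \<open>t\<close>-th summand is the probability of accepting in step \<open>t + 1\<close>.\<close>

definition qtm_accept_prob :: "qtm_wom \<Rightarrow> nat list \<Rightarrow> real" where
  "qtm_accept_prob M w =
     (\<Sum>t. \<Sum>h | length h = t \<and> set h \<subseteq> continue_syms M.
        \<Sum>\<omega>\<in>accept_syms M. history_prob M w (\<omega> # h))"

text \<open>
  Finite computation paths, most recent configuration first; the flag tells whether the last
  step has halted the machine.
\<close>

inductive qtm_path :: "qtm_wom \<Rightarrow> nat list \<Rightarrow> bool \<Rightarrow> config list \<Rightarrow> bool" for M w where
  qtm_path_init: "qtm_path M w False [init_config M]"
| qtm_path_step: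
    "qtm_path M w False (c # cs) \<Longrightarrow> \<omega> \<in> register_syms M \<Longrightarrow> step_amp M w \<omega> d c \<noteq> 0 \<Longrightarrow>
     qtm_path M w (\<omega> \<notin> continue_syms M) (d # c # cs)"

definition qtm_uses_space :: "nat set \<Rightarrow> (nat \<Rightarrow> real) \<Rightarrow> qtm_wom \<Rightarrow> bool" where
  "qtm_uses_space \<Sigma> s M \<longleftrightarrow>
     (\<forall>w\<in>lists \<Sigma>. \<forall>halted cs. qtm_path M w halted cs \<longrightarrow> within_space s w cs)"

definition QTM_WOM_pos_one_sided :: "(nat \<Rightarrow> real) \<Rightarrow> nat set \<Rightarrow> nat list set set" where
  "QTM_WOM_pos_one_sided s \<Sigma> =
     {L. L \<subseteq> lists \<Sigma> \<and>
         (\<exists>M. qtm_wom_ok \<Sigma> M \<and> qtm_uses_space \<Sigma> s M \<and>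
              recognizes_pos_one_sided \<Sigma> (qtm_accept_prob M) L)}"

end

theory Submission
  imports Defs
begin

text \<open>
  Since the write-only memory does not influence a classical machine, it may be assumed to be unused,
  and such a machine is simulated by a quantum one that records the coin tosses and the local
  configuration in its register.

  The separating language consists of the words over \<open>{0, 1}\<close> that are not palindromes.  A quantum
  machine without any work space splits into two branches of equal amplitude.  One of them copies the
  input to the memory from left to right, the other one from right to left, and they end in the same
  position at the same time.  If the input is a palindrome, the memory contents agree, and destructive
  interference excludes acceptance; otherwise there is no interference, and the machine accepts with
  constant probability.

  A classical machine with one-sided error accepts if and only if an accepting configuration is
  reachable.  With \<open>o(log n)\<close> space, there are fewer than \<open>2 ^ n\<close> possible behaviours on the left half of an
  input of length \<open>2 * n\<close>, so two different left halves \<open>x\<close> and \<open>x'\<close> behave alike.  Hence the machine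
  accepts the palindrome \<open>x @ rev x\<close> if it accepts \<open>x' @ rev x\<close>.
\<close>

section \<open>Amplitudes\<close>

text \<open>Well-formedness demands that configurations stay orthogonal once the register is taken
  into account, so information that a step discards must go into the register, and a memory square
  can be flipped but not simply overwritten. On the other hand the register is observed, so whatever
  it receives destroys superposition. The simulation can afford this, as it needs no interference.
  The palindrome machine cannot: both branches must send the same symbols to the register at all
  times. Hence both move the input head over the word and back in the same way and differ only in
  the sweep during which they copy; the parity of the state, which tells the branches apart, is
  erased by the last gate. The acceptance probability of a non-palindrome is 1/4: the initial split
  gives up half of the runs, and on unequal memory contents the final comparison has a fair outcome.
  On the classical side, \<open>c\<close> configurations at the middle of the input allow at most
  \<open>2 ^ ((c + 1)^2)\<close> behaviours, and \<open>c\<close> is exponential in the space. A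
  small enough multiple of \<open>ln n\<close> as space bound therefore keeps
  \<open>(c + 1)^2\<close> of order \<open>sqrt n\<close>.\<close>

definition printer :: "outsym list \<Rightarrow> transducer" where
  "printer out = \<lparr> tstates = {..length out}, tstart = 0, talph = {0, 1}, tblank = 0, tmark = 1,
     tdelta = (\<lambda>q a. if q < length out then Some (Suc q, a, Stay, Some (out ! q)) else None) \<rparr>"

lemma printer_run:
  "(tstep (printer out) ^^ k) (tinit (printer out) n) =
     (min k (length out), 0, (\<lambda>i. if 0 \<le> i \<and> i < int n then 1 else 0), take k out)"
proof (induction k)
  case 0
  show ?case by (auto simp: tinit_def printer_def fun_eq_iff)
next
  case (Suc k)
  show ?case
  proof (cases "k < length out")
    case True
    then have "min k (length out) = k" "min (Suc k) (length out) = Suc k" by auto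
    with Suc True show ?thesis
      by (auto simp: take_Suc_conv_app_nth) (auto simp: printer_def fun_eq_iff)
  next
    case False
    with Suc show ?thesis by (auto simp: printer_def)
  qed
qed

text \<open>The amplitudes used below are all dyadic, so no approximation takes place: one
  transducer prints the same exact expansion for every \<open>n\<close>.\<close>

lemma efficiently_computable_real_fixed_point:
  "efficiently_computable_real (fixed_point_value neg xs ys)"
proof -
  let ?out = "fixed_point_code neg xs ys"
  have ok: "transducer_ok (printer ?out)"
    by (auto simp: transducer_ok_def printer_def split: if_splits)
  \<comment> \<open>Taking \<open>length ?out\<close> for \<open>k\<close> allows at least
    \<open>length ?out\<close> steps, and a halted machine stays as it is.\<close>
  have "let c = (tstep (printer ?out) ^^ (n ^ length ?out + length ?out)) (tinit (printer ?out) n) in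
      thalted (printer ?out) c \<and> toutput c = ?out" for n
    by (simp add: printer_run Let_def) (simp add: printer_def)
  with ok show ?thesis
    unfolding efficiently_computable_real_def Let_def
    by (intro exI[of _ "printer ?out"] exI[of _ "length ?out"] conjI allI
        exI[of _ neg] exI[of _ xs] exI[of _ ys]) auto
qed

lemma efficiently_computable_half_multiples:
  fixes z :: complex
  assumes "z \<in> {0, 1, -1, 1/2, -1/2}"
  shows "efficiently_computable z"
proof -
  have real: "efficiently_computable_real 0" "efficiently_computable_real 1"
    "efficiently_computable_real (-1)" "efficiently_computable_real (1/2)"
    "efficiently_computable_real (-1/2)"
    using efficiently_computable_real_fixed_point[of False "[]" "[]"]
      efficiently_computable_real_fixed_point[of False "[True]" "[]"]
      efficiently_computable_real_fixed_point[of True "[True]" "[]"]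
      efficiently_computable_real_fixed_point[of False "[]" "[True]"]
      efficiently_computable_real_fixed_point[of True "[]" "[True]"]
    by (simp_all add: fixed_point_value_def)
  obtain x where "x \<in> {0, 1, -1, 1/2, -1/2}" "z = of_real x"
  proof -
    have "z \<in> of_real ` {0, 1, -1, 1/2, -1/2}" using assms by simp
    with that show ?thesis by blast
  qed
  with real show ?thesis
    by (auto simp only: efficiently_computable_def Re_complex_of_real Im_complex_of_real insert_iff empty_iff)
qed

section \<open>Sums with a single nonzero term\<close>

lemma infsum_finite_support:
  fixes f :: "'a \<Rightarrow> 'b::{topological_comm_monoid_add, t2_space}"
  assumes "finite F" "F \<subseteq> A" "\<And>x. x \<in> A - F \<Longrightarrow> f x = 0"
  shows "infsum f A = sum f F"
proof -
  have "infsum f A = infsum f F"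
    using assms by (intro infsum_cong_neutral) auto
  with assms(1) show ?thesis by simp
qed

lemma infsum_point:
  fixes f :: "'a \<Rightarrow> 'b::{topological_comm_monoid_add, t2_space}"
  assumes "a \<in> A" "\<And>x. x \<in> A \<Longrightarrow> x \<noteq> a \<Longrightarrow> f x = 0"
  shows "infsum f A = f a"
  using infsum_finite_support[of "{a}" A f] assms by auto

section \<open>Classical machines without the memory\<close>

definition strip :: "ptm_wom \<Rightarrow> ptm_wom" where
  "strip M = M\<lparr>transition := \<lambda>b q \<sigma> \<gamma>. case transition M b q \<sigma> \<gamma> of
     Action q' \<gamma>' mi mw g mg \<Rightarrow> Action q' \<gamma>' mi mw (wom_empty M) Stay\<rparr>"

lemma strip_simps [simp]:
  "states (strip M) = states M" "start (strip M) = start M"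
  "work_alph (strip M) = work_alph M" "work_blank (strip M) = work_blank M"
  "wom_alph (strip M) = wom_alph M" "wom_blank (strip M) = wom_blank M"
  "wom_empty (strip M) = wom_empty M"
  "accept_state (strip M) = accept_state M" "reject_state (strip M) = reject_state M"
  "init_config (strip M) = init_config M" "configs (strip M) w = configs M w"
  "actions (strip M) = actions M"
  by (auto simp: strip_def init_config_def configs_def actions_def)

text \<open>A bisimulation between \<open>M\<close> and \<open>strip M\<close>: the transition reads
  nothing outside these components.\<close>

definition wom_equiv :: "config \<Rightarrow> config \<Rightarrow> bool" where
  "wom_equiv c c' \<longleftrightarrow> state c = state c' \<and> input_pos c = input_pos c' \<and>
     work_pos c = work_pos c' \<and> work_tape c = work_tape c'"

lemma wom_equiv_next:
  assumes "wom_equiv c c'"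
  shows "wom_equiv (ptm_next M w b c) (ptm_next (strip M) w b c')"
  using assms
  by (auto simp: wom_equiv_def ptm_next_def perform_def scanned_input_def scanned_work_def strip_def
      split: action.split)

lemma accept_within_strip:
  "wom_equiv c c' \<Longrightarrow> ptm_accept_within M w t c = ptm_accept_within (strip M) w t c'"
proof (induction t arbitrary: c c')
  case 0
  then show ?case by (simp add: wom_equiv_def)
next
  case (Suc t)
  have "ptm_accept_within M w t (ptm_next M w b c) =
      ptm_accept_within (strip M) w t (ptm_next (strip M) w b c')" for b
    by (intro Suc.IH wom_equiv_next Suc.prems)
  moreover have "state c = state c'" using Suc.prems by (simp add: wom_equiv_def)
  ultimately show ?case by simp
qed

lemma accept_within_bounds: "0 \<le> ptm_accept_within M w t c" "ptm_accept_within M w t c \<le> 1"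
proof (induction t arbitrary: c)
  case (Suc t)
  {
    case 1
    show ?case using Suc by simp
  next
    case 2
    show ?case
      using Suc(2)[of "ptm_next M w False c"] Suc(2)[of "ptm_next M w True c"] by simp
  }
qed auto

lemma accept_prob_strip: "ptm_accept_prob (strip M) w = ptm_accept_prob M w"
  using accept_within_strip[of "init_config M" "init_config M" M w]
  by (simp add: ptm_accept_prob_def wom_equiv_def)

text \<open>Lifted from \<open>strip M\<close> back to \<open>M\<close>, because the space bound is
  assumed for the paths of \<open>M\<close>.\<close>

lemma path_strip:
  "ptm_path (strip M) w cs \<Longrightarrow> \<exists>cs'. ptm_path M w cs' \<and> list_all2 wom_equiv cs' cs"
proof (induction rule: ptm_path.induct)
  case ptm_path_init
  show ?case
    by (intro exI[of _ "[init_config M]"]) (auto intro: ptm_path.intros simp: wom_equiv_def)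
next
  case (ptm_path_step c cs b)
  then obtain c' cs' where *: "ptm_path M w (c' # cs')" "wom_equiv c' c" "list_all2 wom_equiv cs' cs"
    by (auto simp: list_all2_Cons2)
  moreover have "state c' \<notin> {accept_state M, reject_state M}"
    using ptm_path_step * by (auto simp: wom_equiv_def)
  ultimately show ?case
    by (intro exI[of _ "ptm_next M w b c' # c' # cs'"])
      (auto intro: ptm_path.intros wom_equiv_next)
qed

lemma uses_space_strip:
  assumes "ptm_uses_space \<Sigma> s M"
  shows "ptm_uses_space \<Sigma> s (strip M)"
  unfolding ptm_uses_space_def
proof (intro ballI allI impI)
  fix w cs assume w: "w \<in> lists \<Sigma>" and "ptm_path (strip M) w cs"
  then obtain cs' where *: "ptm_path M w cs'" "list_all2 wom_equiv cs' cs"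
    using path_strip by blast
  from *(2) have "work_pos ` set cs' = work_pos ` set cs"
    by (induction rule: list_all2_induct) (auto simp: wom_equiv_def)
  moreover have "within_space s w cs'"
    using assms w *(1) by (auto simp: ptm_uses_space_def)
  ultimately show "within_space s w cs"
    by (simp add: within_space_def)
qed

lemma strip_ok: "ptm_wom_ok \<Sigma> M \<Longrightarrow> ptm_wom_ok \<Sigma> (strip M)"
  unfolding ptm_wom_ok_def
  by (auto simp: strip_def frame_ok_def actions_def respects_ends_def split: action.splits)
    (metis action.sel(1,2,3))+

definition wom_free :: "ptm_wom \<Rightarrow> bool" where
  "wom_free M \<longleftrightarrow> (\<forall>b q \<sigma> \<gamma>. wom_write (transition M b q \<sigma> \<gamma>) = wom_empty M \<and>
     wom_move (transition M b q \<sigma> \<gamma>) = Stay)"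

lemma wom_free_strip: "wom_free (strip M)"
  by (auto simp: wom_free_def strip_def split: action.splits)

lemma wom_free_wlog:
  assumes "L \<in> PTM_WOM_pos_one_sided s \<Sigma>"
  obtains M where "wom_free M" "ptm_wom_ok \<Sigma> M" "ptm_uses_space \<Sigma> s M"
    "recognizes_pos_one_sided \<Sigma> (ptm_accept_prob M) L" "L \<subseteq> lists \<Sigma>"
proof -
  from assms obtain M where M: "ptm_wom_ok \<Sigma> M" "ptm_uses_space \<Sigma> s M"
    "recognizes_pos_one_sided \<Sigma> (ptm_accept_prob M) L" "L \<subseteq> lists \<Sigma>"
    by (auto simp: PTM_WOM_pos_one_sided_def)
  moreover have "ptm_accept_prob (strip M) = ptm_accept_prob M"
    using accept_prob_strip by blast
  ultimately show ?thesis
    by (intro that[of "strip M"]) (auto simp: wom_free_strip strip_ok uses_space_strip)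
qed

text \<open>\<open>sum\<close> over an infinite set is 0 by default, so this is what allows
  evaluating the sum over actions in \<open>step_amp\<close>.\<close>

lemma finite_actions:
  assumes "frame_ok M"
  shows "finite (actions M)"
proof -
  let ?f = "\<lambda>(q, \<gamma>, mi, mw, g, mg). Action q \<gamma> mi mw g mg"
  let ?D = "states M \<times> work_alph M \<times> UNIV \<times> UNIV \<times> wom_alph M \<times> UNIV"
  have "finite (UNIV :: move set)"
    by (rule finite_subset[of _ "{MoveLeft, Stay, MoveRight}"]) (use move.exhaust in auto)
  then have "finite (?f ` ?D)"
    using assms by (intro finite_imageI finite_cartesian_product) (auto simp: frame_ok_def)
  moreover have "a \<in> ?f ` ?D" if "a \<in> actions M" for a
    using that by (cases a) (auto simp: actions_def image_iff)
  ultimately show ?thesis by (meson finite_subset subsetI)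
qed

lemma perform_in_configs:
  assumes "frame_ok M" "c \<in> configs M w" "a \<in> actions M" "respects_ends (scanned_input w c) a"
  shows "perform M a c \<in> configs M w"
proof -
  have "0 \<le> shift (input_move a) (input_pos c) \<and>
      shift (input_move a) (input_pos c) \<le> int (length w) + 1"
    using assms(2,4)
    by (cases "input_move a")
      (auto simp: configs_def scanned_input_def respects_ends_def input_at_def split: if_splits)
  moreover have "finite {i. (f(p := x)) i \<noteq> b}" if "finite {i. f i \<noteq> b}"
    for f :: "int \<Rightarrow> nat" and p x b
    by (rule finite_subset[of _ "insert p {i. f i \<noteq> b}"]) (use that in auto)
  ultimately show ?thesis
    using assms by (auto simp: configs_def perform_def actions_def image_subset_iff)
qed

lemma scanned_in:
  assumes "c \<in> configs M w" "w \<in> lists \<Sigma>"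
  shows "state c \<in> states M" "scanned_input w c \<in> insyms \<Sigma>" "scanned_work c \<in> work_alph M"
proof -
  show "state c \<in> states M" "scanned_work c \<in> work_alph M"
    using assms by (auto simp: configs_def scanned_work_def)
  have "w ! nat (input_pos c - 1) \<in> \<Sigma>" if "0 < input_pos c" "input_pos c \<le> int (length w)"
    using that assms by (auto simp: in_lists_conv_set)
  then show "scanned_input w c \<in> insyms \<Sigma>"
    by (auto simp: scanned_input_def input_at_def insyms_def)
qed

lemma init_in_configs: "frame_ok M \<Longrightarrow> init_config M \<in> configs M w"
  by (auto simp: init_config_def configs_def frame_ok_def)

lemma ptm_next_in_configs:
  assumes "ptm_wom_ok \<Sigma> M" "w \<in> lists \<Sigma>" "c \<in> configs M w"
  shows "ptm_next M w b c \<in> configs M w"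
  unfolding ptm_next_def
  using assms(1) scanned_in[OF assms(3,2)]
  by (intro perform_in_configs assms) (auto simp: ptm_wom_ok_def)

section \<open>Quantum simulation of a classical machine\<close>

instance insym :: countable
  by countable_datatype

type_synonym record_sym = "nat \<times> insym \<times> nat \<times> bool \<times> bool"

definition halt_states :: "ptm_wom \<Rightarrow> nat set" where
  "halt_states M = {accept_state M, reject_state M}"

text \<open>A classical machine halts by entering a state, a quantum one by writing a symbol. A
  halting state is therefore given one idle step, whose record contains that state and thus the
  verdict; as the heads stand still, it costs no space.\<close>

definition sim_action :: "ptm_wom \<Rightarrow> bool \<Rightarrow> nat \<Rightarrow> insym \<Rightarrow> nat \<Rightarrow> action" where
  "sim_action M b q \<sigma> \<gamma> =
     (if q \<in> halt_states M then Action q \<gamma> Stay Stay (wom_empty M) Stay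
      else transition M b q \<sigma> \<gamma>)"

definition record_syms :: "nat set \<Rightarrow> ptm_wom \<Rightarrow> nat set \<Rightarrow> nat set" where
  "record_syms \<Sigma> M Q = (to_nat :: record_sym \<Rightarrow> nat) ` (Q \<times> insyms \<Sigma> \<times> work_alph M \<times> UNIV \<times> UNIV)"

text \<open>
  The memory is left alone, since overwriting it is not reversible.  The register records everything
  that the action depends on, which makes the step injective for each recorded symbol.  Besides the coin
  \<open>b\<close> it records a bit \<open>e\<close> of no effect, so that all amplitudes are \<open>1/2\<close> instead of \<open>1/sqrt 2\<close>.
\<close>

definition sim :: "nat set \<Rightarrow> ptm_wom \<Rightarrow> qtm_wom" where
  "sim \<Sigma> M =
     \<lparr> states = states M, start = start M, work_alph = work_alph M, work_blank = work_blank M,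
       wom_alph = wom_alph M, wom_blank = wom_blank M, wom_empty = wom_empty M,
       accept_syms = record_syms \<Sigma> M {accept_state M},
       reject_syms = record_syms \<Sigma> M {reject_state M},
       continue_syms = record_syms \<Sigma> M (states M - halt_states M),
       amplitude = (\<lambda>q \<sigma> \<gamma> a \<omega>. case from_nat \<omega> :: record_sym of (q', \<sigma>', \<gamma>', b, e) \<Rightarrow>
         if (q', \<sigma>', \<gamma>') = (q, \<sigma>, \<gamma>) \<and> a = sim_action M b q \<sigma> \<gamma> then 1/2 else 0) \<rparr>"

lemma sim_simps [simp]:
  "states (sim \<Sigma> M) = states M" "start (sim \<Sigma> M) = start M"
  "work_alph (sim \<Sigma> M) = work_alph M" "work_blank (sim \<Sigma> M) = work_blank M"
  "wom_alph (sim \<Sigma> M) = wom_alph M" "wom_blank (sim \<Sigma> M) = wom_blank M"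
  "wom_empty (sim \<Sigma> M) = wom_empty M"
  "accept_syms (sim \<Sigma> M) = record_syms \<Sigma> M {accept_state M}"
  "reject_syms (sim \<Sigma> M) = record_syms \<Sigma> M {reject_state M}"
  "continue_syms (sim \<Sigma> M) = record_syms \<Sigma> M (states M - halt_states M)"
  "init_config (sim \<Sigma> M) = init_config M" "configs (sim \<Sigma> M) w = configs M w"
  "actions (sim \<Sigma> M) = actions M" "perform (sim \<Sigma> M) = perform M"
  by (auto simp: sim_def init_config_def configs_def actions_def perform_def fun_eq_iff)

definition sim_next :: "ptm_wom \<Rightarrow> nat list \<Rightarrow> bool \<Rightarrow> config \<Rightarrow> config" where
  "sim_next M w b c = perform M (sim_action M b (state c) (scanned_input w c) (scanned_work c)) c"

definition record_of :: "nat list \<Rightarrow> config \<Rightarrow> bool \<Rightarrow> bool \<Rightarrow> nat" where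
  "record_of w c b e = to_nat (state c, scanned_input w c, scanned_work c, b, e)"

text \<open>The register records the scanned input symbol and has to be finite, hence the condition
  on \<open>\<Sigma>\<close>; \<open>free\<close> makes a recorded step invertible.\<close>

locale simulation =
  fixes \<Sigma> :: "nat set" and M :: ptm_wom
  assumes fin: "finite \<Sigma>" and ok: "ptm_wom_ok \<Sigma> M" and free: "wom_free M"
begin

lemma frame: "frame_ok M"
  using ok by (simp add: ptm_wom_ok_def)

lemma halt_subset: "halt_states M \<subseteq> states M"
  using ok by (auto simp: ptm_wom_ok_def halt_states_def)

lemma sim_action_in:
  assumes "q \<in> states M" "\<sigma> \<in> insyms \<Sigma>" "\<gamma> \<in> work_alph M"
  shows "sim_action M b q \<sigma> \<gamma> \<in> actions M" "respects_ends \<sigma> (sim_action M b q \<sigma> \<gamma>)"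
  using ok assms
  by (auto simp: sim_action_def actions_def respects_ends_def ptm_wom_ok_def frame_ok_def)

lemma sim_action_wom:
  "wom_write (sim_action M b q \<sigma> \<gamma>) = wom_empty M" "wom_move (sim_action M b q \<sigma> \<gamma>) = Stay"
  using free by (auto simp: sim_action_def wom_free_def)

lemma sim_next_in:
  assumes "w \<in> lists \<Sigma>" "c \<in> configs M w"
  shows "sim_next M w b c \<in> configs M w"
  unfolding sim_next_def
  using scanned_in[OF assms(2,1)]
  by (intro perform_in_configs frame assms) (auto intro: sim_action_in)

lemma sim_next_not_halted:
  "state c \<notin> halt_states M \<Longrightarrow> sim_next M w b c = ptm_next M w b c"
  by (simp add: sim_next_def ptm_next_def sim_action_def)

lemma work_pos_sim_next_halted:
  "state c \<in> halt_states M \<Longrightarrow> work_pos (sim_next M w b c) = work_pos c"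
  by (simp add: sim_next_def sim_action_def perform_def)

text \<open>Only the scanned work symbol is overwritten, and it is the same in both configurations;
  head moves are translations.\<close>

lemma perform_inj:
  assumes "wom_write a = wom_empty M" "state c = state c'" "scanned_work c = scanned_work c'"
    "perform M a c = perform M a c'"
  shows "c = c'"
proof -
  have shift_inj: "shift m i = shift m j \<longleftrightarrow> i = j" for m i j by (cases m) auto
  have "(work_tape c)(work_pos c := x) = (work_tape c')(work_pos c := x) \<Longrightarrow>
      work_tape c (work_pos c) = work_tape c' (work_pos c) \<Longrightarrow> work_tape c = work_tape c'" for x
    by (metis fun_upd_idem fun_upd_upd)
  with assms show ?thesis
    by (auto simp: perform_def shift_inj scanned_work_def intro!: config.equality)
qed

lemma register: "register_syms (sim \<Sigma> M) = record_syms \<Sigma> M (states M)"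
  using halt_subset by (auto simp: register_syms_def record_syms_def halt_states_def)

lemma finite_record_syms: "Q \<subseteq> states M \<Longrightarrow> finite (record_syms \<Sigma> M Q)"
  using frame fin
  by (auto simp: record_syms_def insyms_def frame_ok_def intro!: finite_imageI finite_cartesian_product
      intro: finite_subset)

lemma record_of_in:
  assumes "w \<in> lists \<Sigma>" "c \<in> configs M w"
  shows "record_of w c b e \<in> record_syms \<Sigma> M Q \<longleftrightarrow> state c \<in> Q"
  using scanned_in[OF assms(2,1)] by (auto simp: record_of_def record_syms_def)

lemma record_of_eq:
  "record_of w c b e = record_of w c' b' e' \<longleftrightarrow> state c = state c' \<and> scanned_input w c = scanned_input w c' \<and>
     scanned_work c = scanned_work c' \<and> b = b' \<and> e = e'"
  by (auto simp: record_of_def)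

lemma step_amp_other:
  assumes "\<And>b e. \<omega> \<noteq> record_of w c b e" "\<omega> \<in> record_syms \<Sigma> M Q"
  shows "step_amp (sim \<Sigma> M) w \<omega> d c = 0"
proof -
  obtain q \<sigma> \<gamma> b e where \<omega>: "\<omega> = to_nat ((q, \<sigma>, \<gamma>, b, e) :: record_sym)"
    using assms(2) unfolding record_syms_def by blast
  with assms(1)[of b e] have "(q, \<sigma>, \<gamma>) \<noteq> (state c, scanned_input w c, scanned_work c)"
    by (auto simp: record_of_def)
  then show ?thesis
    unfolding step_amp_def by (intro sum.neutral) (auto simp: sim_def \<omega>)
qed

lemma step_amp_record:
  assumes "w \<in> lists \<Sigma>" "c \<in> configs M w"
  shows "step_amp (sim \<Sigma> M) w (record_of w c b e) d c = (if d = sim_next M w b c then 1/2 else 0)"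
proof -
  let ?a = "sim_action M b (state c) (scanned_input w c) (scanned_work c)"
  have "?a \<in> actions M"
    using scanned_in[OF assms(2,1)] by (auto intro: sim_action_in)
  moreover have "amplitude (sim \<Sigma> M) (state c) (scanned_input w c) (scanned_work c) a (record_of w c b e) =
      (if a = ?a then 1/2 else 0)" for a
    by (simp add: sim_def record_of_def)
  moreover have "finite {a \<in> actions M. perform M a c = d}"
    using finite_actions[OF frame] by simp
  ultimately show ?thesis
    by (auto simp: step_amp_def sim_next_def)
qed

lemma sum_record_syms:
  fixes f :: "nat \<Rightarrow> 'a::comm_monoid_add"
  assumes "w \<in> lists \<Sigma>" "c \<in> configs M w" "Q \<subseteq> states M"
    and "\<And>\<omega>. \<omega> \<in> record_syms \<Sigma> M Q \<Longrightarrow> (\<And>b e. \<omega> \<noteq> record_of w c b e) \<Longrightarrow> f \<omega> = 0"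
  shows "sum f (record_syms \<Sigma> M Q) =
    (if state c \<in> Q then \<Sum>b\<in>UNIV. \<Sum>e\<in>UNIV. f (record_of w c b e) else 0)"
proof (cases "state c \<in> Q")
  case True
  have "sum f (record_syms \<Sigma> M Q) = sum f ((\<lambda>(b, e). record_of w c b e) ` UNIV)"
  proof (rule sum.mono_neutral_right)
    show "\<forall>\<omega>\<in>record_syms \<Sigma> M Q - range (\<lambda>(b, e). record_of w c b e). f \<omega> = 0"
      using assms(4) by fast
    show "range (\<lambda>(b, e). record_of w c b e) \<subseteq> record_syms \<Sigma> M Q"
      using True by (auto simp: record_of_in[OF assms(1,2)])
  qed (use assms(3) finite_record_syms in blast)
  also have "\<dots> = (\<Sum>(b, e)\<in>UNIV. f (record_of w c b e))"
    by (subst sum.reindex) (auto simp: inj_on_def record_of_eq case_prod_unfold)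
  finally show ?thesis
    using True by (simp add: sum.cartesian_product UNIV_Times_UNIV[symmetric] del: UNIV_Times_UNIV)
next
  case False
  then have "f \<omega> = 0" if "\<omega> \<in> record_syms \<Sigma> M Q" for \<omega>
    using that assms(4)[OF that] record_of_in[OF assms(1,2)] by blast
  with False show ?thesis
    by (auto intro: sum.neutral)
qed

text \<open>From \<open>c\<close> only the four records with bits \<open>b\<close> and
  \<open>e\<close> can arise, each with one target and amplitude 1/2. The function \<open>g\<close>
  is left open to serve both the inner products of well-formedness and the squared moduli of
  probabilities.\<close>

lemma step_sum:
  fixes g :: "nat \<Rightarrow> config \<Rightarrow> complex \<Rightarrow> 'a::{topological_comm_monoid_add, t2_space}"
  assumes wc: "w \<in> lists \<Sigma>" "c \<in> configs M w" and Q: "Q \<subseteq> states M" and g0: "\<And>\<omega> d. g \<omega> d 0 = 0"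
  shows "(\<Sum>\<omega>\<in>record_syms \<Sigma> M Q. \<Sum>\<^sub>\<infinity>d\<in>configs M w. g \<omega> d (step_amp (sim \<Sigma> M) w \<omega> d c)) =
    (if state c \<in> Q then \<Sum>b\<in>UNIV. \<Sum>e\<in>UNIV. g (record_of w c b e) (sim_next M w b c) (1/2) else 0)"
    (is "sum ?f _ = _")
proof -
  have "?f \<omega> = 0" if "\<omega> \<in> record_syms \<Sigma> M Q" "\<And>b e. \<omega> \<noteq> record_of w c b e" for \<omega>
    using step_amp_other[OF that(2,1)] g0 by (intro infsum_0) simp
  then have "sum ?f (record_syms \<Sigma> M Q) =
      (if state c \<in> Q then \<Sum>b\<in>UNIV. \<Sum>e\<in>UNIV. ?f (record_of w c b e) else 0)"
    by (rule sum_record_syms[OF wc Q])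
  moreover have "?f (record_of w c b e) = g (record_of w c b e) (sim_next M w b c) (1/2)" for b e
    by (subst infsum_point[of "sim_next M w b c"])
      (use wc g0 sim_next_in in \<open>auto simp: step_amp_record\<close>)
  ultimately show ?thesis by simp
qed

text \<open>A record determines the local situation, and among configurations sharing it the
  recorded step is injective, so distinct columns have disjoint supports. The squared norm of a
  column is four times \<open>(1/2)^2\<close>.\<close>

lemma well_formed_sim: "well_formed \<Sigma> (sim \<Sigma> M)"
  unfolding well_formed_def register sim_simps
proof (intro ballI)
  fix w c c' assume w: "w \<in> lists \<Sigma>" and c: "c \<in> configs M w" and c': "c' \<in> configs M w"
  have "step_amp (sim \<Sigma> M) w (record_of w c b e) (sim_next M w b c) c' = (if c = c' then 1/2 else 0)"
    for b e
  proof (cases "state c = state c' \<and> scanned_input w c = scanned_input w c' \<and> scanned_work c = scanned_work c'")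
    case True
    then have "record_of w c b e = record_of w c' b e" by (simp add: record_of_eq)
    moreover have "sim_next M w b c = sim_next M w b c' \<longleftrightarrow> c = c'"
      using True perform_inj[OF sim_action_wom(1), of c c'] by (auto simp: sim_next_def)
    ultimately show ?thesis
      by (simp add: step_amp_record w c')
  next
    case False
    have "step_amp (sim \<Sigma> M) w (record_of w c b e) (sim_next M w b c) c' = 0"
      using False scanned_in(1)[OF c w]
      by (intro step_amp_other[where Q = "states M"]) (auto simp: record_of_eq record_of_in w c)
    with False show ?thesis by auto
  qed
  then show "(\<Sum>\<omega>\<in>record_syms \<Sigma> M (states M). \<Sum>\<^sub>\<infinity>d\<in>configs M w.
      cnj (step_amp (sim \<Sigma> M) w \<omega> d c) * step_amp (sim \<Sigma> M) w \<omega> d c') = (if c = c' then 1 else 0)"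
    using scanned_in(1)[OF c w] by (subst step_sum) (auto simp: w c UNIV_bool)
qed

lemma sim_ok: "qtm_wom_ok \<Sigma> (sim \<Sigma> M)"
proof -
  have "accept_state M \<noteq> reject_state M"
    using ok by (simp add: ptm_wom_ok_def)
  moreover have "amplitude (sim \<Sigma> M) q \<sigma> \<gamma> a \<omega> \<in> {0, 1/2}" for q \<sigma> \<gamma> a \<omega>
    by (auto simp: sim_def split: prod.split)
  then have "efficiently_computable (amplitude (sim \<Sigma> M) q \<sigma> \<gamma> a \<omega>)" for q \<sigma> \<gamma> a \<omega>
    by (intro efficiently_computable_half_multiples) blast
  moreover have "respects_ends \<sigma> a"
    if "q \<in> states M" "\<sigma> \<in> insyms \<Sigma>" "\<gamma> \<in> work_alph M" "amplitude (sim \<Sigma> M) q \<sigma> \<gamma> a \<omega> \<noteq> 0" for q \<sigma> \<gamma> a \<omega>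
    using that sim_action_in(2) by (auto simp: sim_def split: prod.splits if_splits)
  ultimately show ?thesis
    using frame well_formed_sim finite_record_syms
    by (auto simp: qtm_wom_ok_def register frame_ok_def) (auto simp: record_syms_def halt_states_def)
qed

section \<open>Computation paths and space of the simulation\<close>

lemma step_amp_nonzero:
  assumes "\<omega> \<in> register_syms (sim \<Sigma> M)" "step_amp (sim \<Sigma> M) w \<omega> d c \<noteq> 0"
  obtains b e where "\<omega> = record_of w c b e" "d = sim_next M w b c"
proof -
  obtain b e where \<omega>: "\<omega> = record_of w c b e"
    using step_amp_other[of \<omega> w c] assms register by metis
  have "\<exists>a. perform M a c = d \<and> amplitude (sim \<Sigma> M) (state c) (scanned_input w c) (scanned_work c) a \<omega> \<noteq> 0"
    using assms(2) unfolding step_amp_def by (auto elim!: sum.not_neutral_contains_not_neutral)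
  then have "d = sim_next M w b c"
    by (auto simp: sim_def \<omega> record_of_def sim_next_def split: if_splits)
  with \<omega> show ?thesis by (rule that)
qed

text \<open>The last step of a halted quantum path is the idle one and has no classical counterpart,
  so in that case only the visited work squares are compared.\<close>

lemma qtm_path_sim:
  "qtm_path (sim \<Sigma> M) w halted cs \<Longrightarrow>
     (if halted then \<exists>cs'. ptm_path M w cs' \<and> work_pos ` set cs = work_pos ` set cs' else ptm_path M w cs)"
proof (induction rule: qtm_path.induct)
  case qtm_path_init
  show ?case by (auto intro: ptm_path.intros)
next
  case (qtm_path_step c cs \<omega> d)
  obtain b e where \<omega>: "\<omega> = record_of w c b e" and d: "d = sim_next M w b c"
    using step_amp_nonzero qtm_path_step.hyps by metis
  have path: "ptm_path M w (c # cs)"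
    using qtm_path_step.IH by simp
  show ?case
  proof (cases "state c \<in> halt_states M")
    case True
    then have "\<omega> \<notin> continue_syms (sim \<Sigma> M)"
      by (auto simp: \<omega> record_of_def record_syms_def)
    moreover have "work_pos ` set (d # c # cs) = work_pos ` set (c # cs)"
      by (simp add: d work_pos_sim_next_halted True)
    ultimately show ?thesis using path by metis
  next
    case False
    then have "state c \<in> states M - halt_states M"
      using qtm_path_step.hyps(2) by (auto simp: register \<omega> record_of_def record_syms_def)
    then have "\<omega> \<in> continue_syms (sim \<Sigma> M)"
      using qtm_path_step.hyps(2) by (auto simp: register \<omega> record_of_def record_syms_def)
    moreover have "ptm_path M w (d # c # cs)"
      using path False unfolding d sim_next_not_halted[OF False]
      by (auto intro: ptm_path.intros simp: halt_states_def)
    ultimately show ?thesis by simp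
  qed
qed

lemma uses_space_sim:
  assumes "ptm_uses_space \<Sigma> s M"
  shows "qtm_uses_space \<Sigma> s (sim \<Sigma> M)"
  unfolding qtm_uses_space_def
proof (intro ballI allI impI)
  fix w halted cs assume "w \<in> lists \<Sigma>" "qtm_path (sim \<Sigma> M) w halted cs"
  with qtm_path_sim[of w halted cs] obtain cs' where "ptm_path M w cs'" "work_pos ` set cs = work_pos ` set cs'"
    by (auto split: if_splits)
  with assms \<open>w \<in> lists \<Sigma>\<close> show "within_space s w cs"
    by (auto simp: ptm_uses_space_def within_space_def)
qed

section \<open>Acceptance probability of the simulation\<close>

definition run_step :: "nat list \<Rightarrow> (config \<Rightarrow> real) \<Rightarrow> config \<Rightarrow> real" where
  "run_step w g c = (if state c \<in> halt_states M then 0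
     else (g (ptm_next M w False c) + g (ptm_next M w True c)) / 2)"

definition accepting :: "config \<Rightarrow> real" where
  "accepting c = (if state c = accept_state M then 1 else 0)"

lemma run_step_add: "run_step w (\<lambda>c. f c + g c) = (\<lambda>c. run_step w f c + run_step w g c)"
  by (auto simp: run_step_def fun_eq_iff field_simps)

lemma run_step_sum: "finite A \<Longrightarrow> run_step w (\<lambda>c. \<Sum>i\<in>A. f i c) = (\<lambda>c. \<Sum>i\<in>A. run_step w (f i) c)"
  by (induction rule: finite_induct) (simp_all add: run_step_add, simp add: run_step_def fun_eq_iff)

text \<open>\<open>run_step\<close> averages a function over the coin toss and vanishes at halting
  states. Its \<open>i\<close>-th iterate on \<open>accepting\<close> is thus the probability of
  acceptance after exactly \<open>i\<close> steps, which matches the summands of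
  \<open>qtm_accept_prob\<close>.\<close>

lemma accept_within_eq:
  "ptm_accept_within M w t = (\<lambda>c. \<Sum>i\<le>t. (run_step w ^^ i) accepting c)"
proof (induction t)
  case 0
  show ?case by (simp add: fun_eq_iff accepting_def)
next
  case (Suc t)
  have "ptm_accept_within M w (Suc t) c = accepting c + run_step w (ptm_accept_within M w t) c" for c
    by (auto simp: accepting_def run_step_def halt_states_def)
  then show ?case
    by (simp add: Suc run_step_sum sum.atMost_Suc_shift fun_eq_iff del: ptm_accept_within.simps sum.atMost_Suc)
qed

lemma accept_prob_sums: "(\<lambda>t. (run_step w ^^ t) accepting c) sums (SUP t. ptm_accept_within M w t c)"
proof -
  have nonneg: "(run_step w ^^ t) accepting c \<ge> 0" for t c
    by (induction t arbitrary: c) (auto simp: accepting_def run_step_def)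
  have "incseq (\<lambda>t. ptm_accept_within M w t c)"
    by (rule incseq_SucI) (simp add: accept_within_eq nonneg del: ptm_accept_within.simps funpow.simps)
  moreover have "bdd_above (range (\<lambda>t. ptm_accept_within M w t c))"
    using accept_within_bounds(2) by (intro bdd_aboveI2)
  ultimately have "(\<lambda>t. ptm_accept_within M w t c) \<longlonglongrightarrow> (SUP t. ptm_accept_within M w t c)"
    by (intro LIMSEQ_incseq_SUP) auto
  then show ?thesis
    by (simp add: sums_def_le accept_within_eq)
qed

definition histories :: "nat \<Rightarrow> nat list set" where
  "histories t = {h. length h = t \<and> set h \<subseteq> continue_syms (sim \<Sigma> M)}"

text \<open>The records include the coin tosses, so a history fixes the run and nothing interferes.
  A history that cannot occur is covered by amplitude 0 at some configuration.\<close>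

lemma qtm_state_point:
  assumes "w \<in> lists \<Sigma>" "set h \<subseteq> register_syms (sim \<Sigma> M)"
  shows "\<exists>\<alpha>. \<exists>c\<in>configs M w. qtm_state (sim \<Sigma> M) w h = (\<lambda>d. if d = c then \<alpha> else 0)"
  using assms(2)
proof (induction h)
  case Nil
  show ?case
    by (intro exI[of _ 1] bexI[of _ "init_config M"]) (auto simp: init_in_configs frame)
next
  case (Cons \<omega> h)
  then obtain \<alpha> c where c: "c \<in> configs M w" and h: "qtm_state (sim \<Sigma> M) w h = (\<lambda>d. if d = c then \<alpha> else 0)"
    by auto
  have \<omega>h: "qtm_state (sim \<Sigma> M) w (\<omega> # h) d = step_amp (sim \<Sigma> M) w \<omega> d c * \<alpha>" for d
    by (simp add: h) (subst infsum_point[OF c], auto)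
  show ?case
  proof (cases "\<exists>b e. \<omega> = record_of w c b e")
    case True
    then obtain b e where "\<omega> = record_of w c b e" by blast
    with \<omega>h have "qtm_state (sim \<Sigma> M) w (\<omega> # h) = (\<lambda>d. if d = sim_next M w b c then \<alpha>/2 else 0)"
      by (auto simp: fun_eq_iff step_amp_record[OF assms(1) c] simp del: qtm_state.simps)
    then show ?thesis
      using sim_next_in[OF assms(1) c] by blast
  next
    case False
    then have "step_amp (sim \<Sigma> M) w \<omega> d c = 0" for d
      using Cons.prems register by (intro step_amp_other[where Q = "states M"]) auto
    then have "qtm_state (sim \<Sigma> M) w (\<omega> # h) = (\<lambda>d. if d = c then 0 else 0)"
      by (simp add: fun_eq_iff \<omega>h del: qtm_state.simps)
    with c show ?thesis by blast
  qed
qed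

definition weight :: "nat list \<Rightarrow> (config \<Rightarrow> real) \<Rightarrow> nat list \<Rightarrow> real" where
  "weight w g h = (\<Sum>\<^sub>\<infinity>d\<in>configs M w. (cmod (qtm_state (sim \<Sigma> M) w h d))\<^sup>2 * g d)"

text \<open>\<open>weight\<close> is an expectation over the unnormalized state, so the latest
  observation can be shifted from the history to the function \<open>g\<close>. The two values of
  \<open>e\<close> contribute \<open>(1/2)^2\<close> each, which gives every coin outcome its weight
  1/2.\<close>

lemma weight_step:
  assumes w: "w \<in> lists \<Sigma>" and h: "set h \<subseteq> register_syms (sim \<Sigma> M)" and Q: "Q \<subseteq> states M"
  shows "(\<Sum>\<omega>\<in>record_syms \<Sigma> M Q. weight w g (\<omega> # h)) =
    weight w (\<lambda>c. if state c \<in> Q then (g (sim_next M w False c) + g (sim_next M w True c)) / 2 else 0) h"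
proof -
  obtain \<alpha> c where c: "c \<in> configs M w" and h: "qtm_state (sim \<Sigma> M) w h = (\<lambda>d. if d = c then \<alpha> else 0)"
    using qtm_state_point[OF w h] by blast
  have \<omega>h: "qtm_state (sim \<Sigma> M) w (\<omega> # h) d = step_amp (sim \<Sigma> M) w \<omega> d c * \<alpha>" for \<omega> d
    by (simp add: h) (subst infsum_point[OF c], auto)
  have *: "weight w f h = (cmod \<alpha>)\<^sup>2 * f c" for f
    by (simp add: weight_def h) (subst infsum_point[OF c], auto)
  show ?thesis
    using step_sum[OF w c Q, of "\<lambda>_ d z. (cmod (z * \<alpha>))\<^sup>2 * g d"]
    by (simp only: * weight_def[of w g] \<omega>h)
      (auto simp: UNIV_bool norm_mult norm_divide power_mult_distrib power2_eq_square field_simps)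
qed

lemma histories_Suc: "histories (Suc t) = (\<lambda>(\<omega>, h). \<omega> # h) ` (continue_syms (sim \<Sigma> M) \<times> histories t)"
  by (auto simp: histories_def length_Suc_conv image_iff)

lemma sum_weight:
  assumes "w \<in> lists \<Sigma>"
  shows "(\<Sum>h\<in>histories t. weight w g h) = (run_step w ^^ t) g (init_config M)"
\<comment> \<open>The head of a history is its latest observation, so the run is peeled off from its
  end, which changes \<open>g\<close>.\<close>
proof (induction t arbitrary: g)
  case 0
  have "histories 0 = {[]}" by (auto simp: histories_def)
  then show ?case
    by (simp add: weight_def) (subst infsum_point[of "init_config M"], auto simp: init_in_configs frame)
next
  case (Suc t)
  have step: "(\<Sum>\<omega>\<in>continue_syms (sim \<Sigma> M). weight w g (\<omega> # h)) = weight w (run_step w g) h"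
    if "h \<in> histories t" for h
  proof -
    have "set h \<subseteq> register_syms (sim \<Sigma> M)"
      using that by (auto simp: histories_def register record_syms_def)
    then have "(\<Sum>\<omega>\<in>continue_syms (sim \<Sigma> M). weight w g (\<omega> # h)) =
        weight w (\<lambda>c. if state c \<in> states M - halt_states M
          then (g (sim_next M w False c) + g (sim_next M w True c)) / 2 else 0) h"
      unfolding sim_simps by (rule weight_step[OF assms]) auto
    also have "\<dots> = weight w (run_step w g) h"
      unfolding weight_def
      by (intro infsum_cong) (auto simp: run_step_def sim_next_not_halted configs_def)
    finally show ?thesis .
  qed
  have "(\<Sum>h\<in>histories (Suc t). weight w g h) =
      (\<Sum>(\<omega>, h)\<in>continue_syms (sim \<Sigma> M) \<times> histories t. weight w g (\<omega> # h))"
    unfolding histories_Suc by (subst sum.reindex) (auto simp: inj_on_def case_prod_unfold)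
  also have "\<dots> = (\<Sum>h\<in>histories t. \<Sum>\<omega>\<in>continue_syms (sim \<Sigma> M). weight w g (\<omega> # h))"
    by (subst sum.swap) (simp add: sum.cartesian_product)
  also have "\<dots> = (\<Sum>h\<in>histories t. weight w (run_step w g) h)"
    by (intro sum.cong refl step)
  finally show ?case
    by (simp add: Suc funpow_swap1)
qed

lemma accept_prob_sim:
  assumes "w \<in> lists \<Sigma>"
  shows "qtm_accept_prob (sim \<Sigma> M) w = ptm_accept_prob M w"
proof -
  have "(\<Sum>\<omega>\<in>accept_syms (sim \<Sigma> M). history_prob (sim \<Sigma> M) w (\<omega> # h)) = weight w accepting h"
    if "h \<in> histories t" for h t
  proof -
    have "set h \<subseteq> register_syms (sim \<Sigma> M)"
      using that by (auto simp: histories_def register record_syms_def)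
    \<comment> \<open>For the constant function 1, \<open>weight\<close> is
      \<open>history_prob\<close>; an accepting record is written exactly in the idle step of the
      accepting state.\<close>
    then have "(\<Sum>\<omega>\<in>accept_syms (sim \<Sigma> M). weight w (\<lambda>_. 1) (\<omega> # h)) = 
        weight w (\<lambda>c. if state c \<in> {accept_state M} then (1 + 1) / 2 else 0) h"
      unfolding sim_simps using halt_subset by (intro weight_step[OF assms]) (auto simp: halt_states_def)
    then show ?thesis
      by (simp add: weight_def history_prob_def accepting_def cong: if_cong)
  qed
  then have "qtm_accept_prob (sim \<Sigma> M) w = (\<Sum>t. \<Sum>h\<in>histories t. weight w accepting h)"
    unfolding qtm_accept_prob_def histories_def[symmetric] by simp
  also have "\<dots> = (\<Sum>t. (run_step w ^^ t) accepting (init_config M))"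
    by (simp add: sum_weight assms)
  also have "\<dots> = ptm_accept_prob M w"
    unfolding ptm_accept_prob_def using accept_prob_sums by (rule sums_unique[symmetric])
  finally show ?thesis .
qed

end

theorem PTM_WOM_subset_QTM_WOM:
  assumes "finite \<Sigma>"
  shows "PTM_WOM_pos_one_sided s \<Sigma> \<subseteq> QTM_WOM_pos_one_sided s \<Sigma>"
proof
  fix L assume "L \<in> PTM_WOM_pos_one_sided s \<Sigma>"
  then obtain M where M: "wom_free M" "ptm_wom_ok \<Sigma> M" "ptm_uses_space \<Sigma> s M"
    "recognizes_pos_one_sided \<Sigma> (ptm_accept_prob M) L" "L \<subseteq> lists \<Sigma>"
    by (rule wom_free_wlog)
  interpret simulation \<Sigma> M
    using assms M by unfold_locales
  have "recognizes_pos_one_sided \<Sigma> (qtm_accept_prob (sim \<Sigma> M)) L"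
    using M(4) unfolding recognizes_pos_one_sided_def by (simp add: accept_prob_sim)
  with M sim_ok uses_space_sim show "L \<in> QTM_WOM_pos_one_sided s \<Sigma>"
    by (auto simp: QTM_WOM_pos_one_sided_def)
qed

section \<open>Acceptance as reachability\<close>

definition ptm_move :: "ptm_wom \<Rightarrow> nat list \<Rightarrow> config \<Rightarrow> config \<Rightarrow> bool" where
  "ptm_move M w c d \<longleftrightarrow> state c \<notin> halt_states M \<and> (\<exists>b. d = ptm_next M w b c)"

lemma accept_within_pos_reach:
  "0 < ptm_accept_within M w t c \<Longrightarrow> \<exists>d. (ptm_move M w)\<^sup>*\<^sup>* c d \<and> state d = accept_state M"
proof (induction t arbitrary: c)
  case 0
  then show ?case by (auto split: if_splits)
next
  case (Suc t)
  show ?case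
  proof (cases "state c \<in> halt_states M")
    case True
    with Suc.prems show ?thesis by (auto simp: halt_states_def split: if_splits)
  next
    case False
    then have "0 < ptm_accept_within M w t (ptm_next M w False c) + ptm_accept_within M w t (ptm_next M w True c)"
      using Suc.prems by (simp add: halt_states_def)
    then obtain b where "0 < ptm_accept_within M w t (ptm_next M w b c)"
      by (metis add_nonpos_nonpos linorder_not_less)
    then obtain d where "(ptm_move M w)\<^sup>*\<^sup>* (ptm_next M w b c) d" "state d = accept_state M"
      using Suc.IH by blast
    moreover have "ptm_move M w c (ptm_next M w b c)"
      using False by (auto simp: ptm_move_def)
    ultimately show ?thesis
      by (meson converse_rtranclp_into_rtranclp)
  qed
qed

lemma reach_accept_within_pos:
  assumes "(ptm_move M w)\<^sup>*\<^sup>* c d" "state d = accept_state M"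
  shows "\<exists>t. 0 < ptm_accept_within M w t c"
  using assms
proof (induction rule: converse_rtranclp_induct)
  case base
  then show ?case by (intro exI[of _ 0]) simp
next
  case (step c c')
  then obtain t b where "0 < ptm_accept_within M w t c'" "state c \<notin> halt_states M" "c' = ptm_next M w b c"
    by (auto simp: ptm_move_def)
  then have "0 < ptm_accept_within M w (Suc t) c"
    using accept_within_bounds(1)[of M w t]
    by (cases b) (auto simp: halt_states_def intro: add_pos_nonneg add_nonneg_pos)
  then show ?case by blast
qed

definition ptm_reaches_accept :: "ptm_wom \<Rightarrow> nat list \<Rightarrow> bool" where
  "ptm_reaches_accept M w \<longleftrightarrow> (\<exists>d. (ptm_move M w)\<^sup>*\<^sup>* (init_config M) d \<and> state d = accept_state M)"

lemma accept_prob_pos_iff: "0 < ptm_accept_prob M w \<longleftrightarrow> ptm_reaches_accept M w"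
proof -
  have "bdd_above (range (\<lambda>t. ptm_accept_within M w t (init_config M)))"
    using accept_within_bounds(2) by (intro bdd_aboveI2)
  then have "0 < ptm_accept_prob M w \<longleftrightarrow> (\<exists>t. 0 < ptm_accept_within M w t (init_config M))"
    unfolding ptm_accept_prob_def by (subst less_cSUP_iff) auto
  then show ?thesis
    unfolding ptm_reaches_accept_def using accept_within_pos_reach reach_accept_within_pos by blast
qed

lemma reach_path:
  "(ptm_move M w)\<^sup>*\<^sup>* (init_config M) c \<Longrightarrow> \<exists>cs. ptm_path M w (c # cs)"
proof (induction rule: rtranclp_induct)
  case base
  show ?case by (auto intro: ptm_path.intros)
next
  case (step c d)
  then show ?case
    by (auto simp: ptm_move_def halt_states_def intro: ptm_path.intros)
qed

section \<open>Classical machines cannot recognize the non-palindromes\<close>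

lemma interval_grow:
  fixes p q :: int
  assumes "\<bar>q - p\<bar> \<le> 1"
  shows "{min 0 q..max 0 q} \<subseteq> insert q {min 0 p..max 0 p}"
proof
  fix i assume "i \<in> {min 0 q..max 0 q}"
  then have "min 0 q \<le> i" "i \<le> max 0 q" by simp_all
  with assms have "i = q \<or> min 0 p \<le> i \<and> i \<le> max 0 p" by linarith
  then show "i \<in> insert q {min 0 p..max 0 p}" by simp
qed

text \<open>The work head moves by at most one square, so it cannot be far from 0 without having
  visited everything in between: counting visited squares bounds the positions and the nonblank part
  of the tape. The third claim gives every earlier configuration a path of its own, to which the
  first one applies.\<close>

lemma ptm_path_visited:
  assumes "ptm_path M w cs"
  shows "{min 0 (work_pos (hd cs))..max 0 (work_pos (hd cs))} \<subseteq> work_pos ` set cs"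
    and "{i. work_tape (hd cs) i \<noteq> work_blank M} \<subseteq> work_pos ` set cs"
    and "\<And>c. c \<in> set cs \<Longrightarrow> \<exists>cs'. ptm_path M w (c # cs') \<and> set cs' \<subseteq> set cs"
  using assms
proof (induction rule: ptm_path.induct)
  case ptm_path_init
  {
    case 1 show ?case by (simp add: init_config_def)
  next
    case 2 show ?case by (simp add: init_config_def)
  next
    case 3 then show ?case by (auto intro: ptm_path.intros)
  }
next
  case (ptm_path_step c cs b)
  {
    case 1
    have "\<bar>work_pos (ptm_next M w b c) - work_pos c\<bar> \<le> 1"
      unfolding ptm_next_def perform_def
      by (cases "work_move (transition M b (state c) (scanned_input w c) (scanned_work c))") auto
    then have "{min 0 (work_pos (ptm_next M w b c))..max 0 (work_pos (ptm_next M w b c))}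
        \<subseteq> insert (work_pos (ptm_next M w b c)) {min 0 (work_pos c)..max 0 (work_pos c)}"
      by (rule interval_grow)
    with ptm_path_step(3) show ?case by (simp only: list.sel list.set image_insert) blast
  next
    case 2
    show ?case using ptm_path_step(4) by (auto simp: ptm_next_def perform_def)
  next
    case (3 d)
    show ?case
    proof (cases "d \<in> set (c # cs)")
      case True
      then obtain cs' where "ptm_path M w (d # cs')" "set cs' \<subseteq> set (c # cs)"
        using ptm_path_step(5) by blast
      then show ?thesis by (meson set_subset_Cons subset_trans)
    next
      case False
      with 3 have d: "d = ptm_next M w b c" by simp
      have "ptm_path M w (d # c # cs)"
        unfolding d using ptm_path_step(1,2) by (rule ptm_path.intros)
      then show ?thesis by (meson set_subset_Cons)
    qed
  }
qed

text \<open>Formulated with \<open>x\<close> as the whole input, hence independent of what follows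
  \<open>x\<close>. The guard concerns the source only, so a run may end on square
  \<open>length x + 1\<close>, just outside.\<close>

definition left_move :: "ptm_wom \<Rightarrow> nat list \<Rightarrow> config \<Rightarrow> config \<Rightarrow> bool" where
  "left_move M x c d \<longleftrightarrow> input_pos c \<le> int (length x) \<and> ptm_move M x c d"

lemma ptm_next_input_at_cong:
  "input_at w (input_pos c) = input_at w' (input_pos c) \<Longrightarrow> ptm_next M w b c = ptm_next M w' b c"
  by (simp add: ptm_next_def scanned_input_def)

lemma ptm_move_left:
  assumes "input_pos c \<le> int (length x)"
  shows "ptm_move M (x @ y) c d \<longleftrightarrow> ptm_move M x c d"
proof -
  have "input_at (x @ y) (input_pos c) = input_at x (input_pos c)"
    using assms by (auto simp: input_at_def nth_append)
  then have "ptm_next M (x @ y) b c = ptm_next M x b c" for b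
    by (rule ptm_next_input_at_cong)
  then show ?thesis
    by (simp add: ptm_move_def)
qed

lemma ptm_move_right:
  assumes "int (length x) < input_pos c" "length x = length x'"
  shows "ptm_move M (x @ y) c d \<longleftrightarrow> ptm_move M (x' @ y) c d"
proof -
  have "input_at (x @ y) (input_pos c) = input_at (x' @ y) (input_pos c)"
    using assms by (auto simp: input_at_def nth_append)
  then have "ptm_next M (x @ y) b c = ptm_next M (x' @ y) b c" for b
    by (rule ptm_next_input_at_cong)
  then show ?thesis
    by (simp add: ptm_move_def)
qed

lemma left_moves_append: "(left_move M x)\<^sup>*\<^sup>* c d \<Longrightarrow> (ptm_move M (x @ y))\<^sup>*\<^sup>* c d"
  by (induction rule: rtranclp_induct)
    (auto simp: left_move_def ptm_move_left intro: rtranclp.rtrancl_into_rtrancl)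

lemma input_pos_move:
  assumes "ptm_move M w c d"
  shows "\<bar>input_pos d - input_pos c\<bar> \<le> 1"
proof -
  have "\<bar>shift m i - i\<bar> \<le> 1" for m i by (cases m) auto
  with assms show ?thesis
    by (auto simp: ptm_move_def ptm_next_def perform_def)
qed

text \<open>
  What the left part \<open>x\<close> of the input does to a computation that enters it in a configuration of \<open>C\<close>,
  or starts in it: in which configurations of \<open>C\<close> it can be left, and whether it can accept inside.
\<close>

definition crossing :: "ptm_wom \<Rightarrow> config set \<Rightarrow> nat list \<Rightarrow> (config \<times> config) set \<times> config set" where
  "crossing M C x =
     ({(e, f). e \<in> insert (init_config M) C \<and> f \<in> C \<and> (left_move M x)\<^sup>*\<^sup>* e f},
      {e \<in> insert (init_config M) C. \<exists>f. state f = accept_state M \<and> (left_move M x)\<^sup>*\<^sup>* e f})"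

text \<open>Cut and paste at the border: the pieces of the computation on \<open>y\<close> are kept,
  and every piece on \<open>x'\<close> is replaced by one on \<open>x\<close> with the same entry
  and exit.\<close>

lemma crossing_transfer:
  assumes len: "length x = length x'" and eq: "crossing M C x = crossing M C x'"
    and C: "\<And>c. (ptm_move M (x' @ y))\<^sup>*\<^sup>* (init_config M) c \<Longrightarrow>
      input_pos c \<in> {int (length x), int (length x) + 1} \<Longrightarrow> c \<in> C"
    and acc: "ptm_reaches_accept M (x' @ y)"
  shows "ptm_reaches_accept M (x @ y)"
proof -
  let ?n = "int (length x)" and ?I = "init_config M"
  have B: "(left_move M x)\<^sup>*\<^sup>* e f \<longleftrightarrow> (left_move M x')\<^sup>*\<^sup>* e f"
    if "e \<in> insert ?I C" "f \<in> C" for e f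
  proof -
    have "(e, f) \<in> fst (crossing M C x) \<longleftrightarrow> (e, f) \<in> fst (crossing M C x')" by (simp add: eq)
    with that show ?thesis by (simp add: crossing_def)
  qed
  have A: "(\<exists>f. state f = accept_state M \<and> (left_move M x)\<^sup>*\<^sup>* e f) \<longleftrightarrow>
      (\<exists>f. state f = accept_state M \<and> (left_move M x')\<^sup>*\<^sup>* e f)" if "e \<in> insert ?I C" for e
  proof -
    have "e \<in> snd (crossing M C x) \<longleftrightarrow> e \<in> snd (crossing M C x')" by (simp add: eq)
    with that show ?thesis by (simp add: crossing_def)
  qed
  \<comment> \<open>Inside the left part the current configuration has no counterpart on
    \<open>x\<close>. Only its entry \<open>e\<close> is known to be reachable there, and the
    replacement waits for the exit or for acceptance.\<close>
  let ?P = "\<lambda>c. if ?n < input_pos c then (ptm_move M (x @ y))\<^sup>*\<^sup>* ?I c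
    else \<exists>e\<in>insert ?I C. (ptm_move M (x @ y))\<^sup>*\<^sup>* ?I e \<and> (left_move M x')\<^sup>*\<^sup>* e c"
  have inv: "?P c" if "(ptm_move M (x' @ y))\<^sup>*\<^sup>* ?I c" for c
    using that
  proof (induction rule: rtranclp_induct)
    case base
    show ?case by (auto simp: init_config_def)
  next
    case (step c d)
    have d: "(ptm_move M (x' @ y))\<^sup>*\<^sup>* ?I d" using step by auto
    have pos: "\<bar>input_pos d - input_pos c\<bar> \<le> 1" using step(2) by (rule input_pos_move)
    show ?case
    proof (cases "?n < input_pos c")
      case True
      then have "ptm_move M (x @ y) c d"
        using step(2) ptm_move_right[OF True len] by simp
      with step.IH True have r: "(ptm_move M (x @ y))\<^sup>*\<^sup>* ?I d"
        by (auto intro: rtranclp.rtrancl_into_rtrancl)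
      show ?thesis
      proof (cases "?n < input_pos d")
        case False
        then have "input_pos d = ?n" using pos True by linarith
        then have "d \<in> C" using C d by simp
        with r False show ?thesis by auto
      qed (use r in simp)
    next
      case False
      then obtain e where e: "e \<in> insert ?I C" "(ptm_move M (x @ y))\<^sup>*\<^sup>* ?I e" "(left_move M x')\<^sup>*\<^sup>* e c"
        using step.IH by auto
      have "left_move M x' c d"
        using step(2) False len ptm_move_left[of c x'] by (auto simp: left_move_def)
      with e have ed: "(left_move M x')\<^sup>*\<^sup>* e d" by auto
      show ?thesis
      proof (cases "?n < input_pos d")
        case True
        then have "input_pos d = ?n + 1" using pos False by linarith
        then have "d \<in> C" using C d by simp
        then have "(left_move M x)\<^sup>*\<^sup>* e d" using ed B e(1) by blast
        then have "(ptm_move M (x @ y))\<^sup>*\<^sup>* e d" by (rule left_moves_append)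
        with e(2) True show ?thesis by auto
      qed (use e ed in auto)
    qed
  qed
  obtain d where d: "(ptm_move M (x' @ y))\<^sup>*\<^sup>* ?I d" "state d = accept_state M"
    using acc by (auto simp: ptm_reaches_accept_def)
  show ?thesis
  proof (cases "?n < input_pos d")
    case True
    with inv[OF d(1)] d(2) show ?thesis by (auto simp: ptm_reaches_accept_def)
  next
    case False
    then obtain e where e: "e \<in> insert ?I C" "(ptm_move M (x @ y))\<^sup>*\<^sup>* ?I e" "(left_move M x')\<^sup>*\<^sup>* e d"
      using inv[OF d(1)] by auto
    then obtain f where f: "state f = accept_state M" "(left_move M x)\<^sup>*\<^sup>* e f"
      using A d(2) by blast
    then have "(ptm_move M (x @ y))\<^sup>*\<^sup>* ?I f"
      using e(2) left_moves_append[OF f(2)] by (meson rtranclp_trans)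
    with f show ?thesis by (auto simp: ptm_reaches_accept_def)
  qed
qed

text \<open>The left part is entered at square \<open>n\<close> and left to square
  \<open>n + 1\<close>, so both positions occur. The memory components are the initial ones, as the
  machine will be \<open>wom_free\<close>.\<close>

definition boundary_configs :: "ptm_wom \<Rightarrow> nat \<Rightarrow> nat \<Rightarrow> config set" where
  "boundary_configs M n K = {c. state c \<in> states M \<and> input_pos c \<in> {int n, int n + 1} \<and>
     work_pos c \<in> {- int K..int K} \<and> range (work_tape c) \<subseteq> work_alph M \<and>
     {i. work_tape c i \<noteq> work_blank M} \<subseteq> {- int K..int K} \<and>
     wom_pos c = 0 \<and> wom_tape c = (\<lambda>_. wom_blank M)}"

lemma boundary_configs_card:
  assumes "frame_ok M"
  shows "finite (boundary_configs M n K)"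
    and "card (boundary_configs M n K) \<le>
      card (states M) * (2 * ((2 * K + 1) * card (work_alph M) ^ (2 * K + 1)))"
proof -
  let ?f = "\<lambda>(q, i, p, t). \<lparr>state = q, input_pos = i, work_pos = p,
     work_tape = (\<lambda>j. if j \<in> {- int K..int K} then t j else work_blank M),
     wom_pos = 0, wom_tape = (\<lambda>_. wom_blank M)\<rparr>"
  let ?D = "states M \<times> {int n, int n + 1} \<times> {- int K..int K} \<times> (PiE {- int K..int K} (\<lambda>_. work_alph M))"
  have sub: "boundary_configs M n K \<subseteq> ?f ` ?D"
  proof
    fix c assume c: "c \<in> boundary_configs M n K"
    then have "work_tape c j = work_blank M" if "j \<notin> {- int K..int K}" for j
      using that unfolding boundary_configs_def by blast
    then have "c = ?f (state c, input_pos c, work_pos c, restrict (work_tape c) {- int K..int K})"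
      using c by (auto simp: boundary_configs_def fun_eq_iff intro!: config.equality)
    moreover have "(state c, input_pos c, work_pos c, restrict (work_tape c) {- int K..int K}) \<in> ?D"
      using c by (auto simp: boundary_configs_def)
    ultimately show "c \<in> ?f ` ?D" by blast
  qed
  have finD: "finite ?D"
    using assms by (auto simp: frame_ok_def intro!: finite_PiE)
  with sub show "finite (boundary_configs M n K)"
    by (meson finite_imageI finite_subset)
  have "card (boundary_configs M n K) \<le> card (?f ` ?D)"
    using sub finD by (intro card_mono finite_imageI)
  also have "\<dots> \<le> card ?D"
    using finD by (rule card_image_le)
  also have "card {- int K..int K} = 2 * K + 1" by simp
  then have "card ?D = card (states M) * (2 * ((2 * K + 1) * card (work_alph M) ^ (2 * K + 1)))"
    by (simp only: card_cartesian_product card_PiE finite_atLeastAtMost_int prod_constant) simp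
  finally show "card (boundary_configs M n K) \<le>
      card (states M) * (2 * ((2 * K + 1) * card (work_alph M) ^ (2 * K + 1)))" .
qed

lemma reachable_in_boundary:
  assumes ok: "ptm_wom_ok \<Sigma> M" and free: "wom_free M" and space: "ptm_uses_space \<Sigma> s M"
    and w: "w \<in> lists \<Sigma>" and reach: "(ptm_move M w)\<^sup>*\<^sup>* (init_config M) c"
    and K: "max 1 (s (length w)) < real K + 1"
    and pos: "input_pos c \<in> {int n, int n + 1}"
  shows "c \<in> boundary_configs M n K"
proof -
  have conf: "c \<in> configs M w \<and> wom_pos c = 0 \<and> wom_tape c = (\<lambda>_. wom_blank M)"
    using reach
  proof (induction rule: rtranclp_induct)
    case base
    show ?case
      using ok init_in_configs[of M w] by (auto simp: ptm_wom_ok_def) (auto simp: init_config_def)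
  next
    case (step c d)
    then obtain b where d: "d = ptm_next M w b c" by (auto simp: ptm_move_def)
    have "wom_pos d = wom_pos c" "wom_tape d = wom_tape c"
      using free by (auto simp: d ptm_next_def perform_def wom_free_def)
    with step.IH show ?case
      using ptm_next_in_configs[OF ok w] by (auto simp: d)
  qed
  obtain cs where path: "ptm_path M w (c # cs)" using reach_path[OF reach] by blast
  let ?V = "work_pos ` set (c # cs)"
  have "real (card ?V) \<le> max 1 (s (length w))"
    using space w path by (auto simp only: ptm_uses_space_def within_space_def)
  with K have cardV: "card ?V \<le> K" by linarith
  have bound: "\<bar>work_pos d\<bar> \<le> int K" if d: "d \<in> set (c # cs)" for d
  proof -
    obtain cs' where cs': "ptm_path M w (d # cs')" "set cs' \<subseteq> set (c # cs)"
      using ptm_path_visited(3)[OF path d] by blast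
    have "{min 0 (work_pos d)..max 0 (work_pos d)} \<subseteq> work_pos ` set (d # cs')"
      using ptm_path_visited(1)[OF cs'(1)] by (simp only: list.sel)
    also have "\<dots> \<subseteq> ?V"
      using cs'(2) d by (intro image_mono) auto
    finally have "card {min 0 (work_pos d)..max 0 (work_pos d)} \<le> card ?V"
      by (intro card_mono) auto
    with cardV show ?thesis by (auto simp: min_def max_def split: if_splits)
  qed
  then have V: "?V \<subseteq> {- int K..int K}"
    by (fastforce simp: abs_le_iff)
  have "{i. work_tape c i \<noteq> work_blank M} \<subseteq> {- int K..int K}"
    using ptm_path_visited(2)[OF path] V by (simp only: list.sel)
  then show ?thesis
    using conf pos V by (auto simp: boundary_configs_def configs_def)
qed

text \<open>Pigeonhole: for \<open>c\<close> boundary configurations a crossing table consists of at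
  most \<open>(c + 1) * c\<close> bits for the pairs and \<open>c + 1\<close> bits for acceptance,
  which makes \<open>(c + 1)^2\<close>, against \<open>2 ^ n\<close> words.\<close>

lemma crossing_collision:
  assumes "frame_ok M" "n > (card (boundary_configs M n K) + 1)\<^sup>2"
  obtains x x' where "x \<in> lists {0, 1}" "x' \<in> lists {0, 1}" "length x = n" "length x' = n" "x \<noteq> x'"
    "crossing M (boundary_configs M n K) x = crossing M (boundary_configs M n K) x'"
proof -
  let ?C = "boundary_configs M n K"
  let ?C' = "insert (init_config M) ?C"
  let ?W = "{x. set x \<subseteq> {0::nat, 1} \<and> length x = n}"
  let ?T = "Pow (?C' \<times> ?C) \<times> Pow ?C'"
  have fin: "finite ?C" using boundary_configs_card(1)[OF assms(1)] .
  have "card ?C' \<le> card ?C + 1" by (simp add: card_insert_if fin)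
  then have "card ?C' * card ?C + card ?C' \<le> (card ?C + 1) * card ?C + (card ?C + 1)"
    by (intro add_mono mult_mono) auto
  also have "\<dots> = (card ?C + 1)\<^sup>2" by (simp add: power2_eq_square)
  also note assms(2)
  finally have "card ?T < 2 ^ n"
    using fin by (simp add: card_cartesian_product card_Pow power_add[symmetric])
  also have "2 ^ n = card ?W" by (subst card_lists_length_eq) (auto simp: numeral_2_eq_2)
  finally have "card ?T < card ?W" .
  moreover have "crossing M ?C ` ?W \<subseteq> ?T" by (auto simp: crossing_def)
  then have "card (crossing M ?C ` ?W) \<le> card ?T"
    using fin by (intro card_mono) auto
  ultimately have "\<not> inj_on (crossing M ?C) ?W"
    by (intro pigeonhole) linarith
  then obtain x x' where "x \<in> ?W" "x' \<in> ?W" "x \<noteq> x'" "crossing M ?C x = crossing M ?C x'"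
    unfolding inj_on_def by blast
  then show ?thesis
    by (intro that[of x x']) (auto simp: lists_eq_set)
qed

definition nonpalindromes :: "nat list set" where
  "nonpalindromes = {w \<in> lists {0, 1}. rev w \<noteq> w}"

lemma length_with_few_configs:
  fixes s :: "nat \<Rightarrow> real"
  assumes s: "s \<in> o(\<lambda>n. ln (real n))" and "frame_ok M"
  obtains n where "n > (card (boundary_configs M n (nat \<lfloor>max 1 (s (2 * n))\<rfloor>)) + 1)\<^sup>2"
proof -
  let ?a = "real (card (states M))" and ?g = "real (card (work_alph M))"
  have "card (states M) > 0" "card (work_alph M) > 0"
    using assms(2) by (auto simp: frame_ok_def card_gt_0_iff)
  then have a: "?a \<ge> 1" and g: "?g \<ge> 1" by linarith+
  \<comment> \<open>The factor 2 absorbs the number of head positions, by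
    \<open>2 * K + 1 < 2 ^ (2 * K + 1)\<close>.\<close>
  define G where "G = ln (2 * ?g)"
  have G: "G > 0" using g by (simp add: G_def)
  have expG: "exp (real k * G) = (2 * ?g) ^ k" for k
    using g by (simp add: G_def exp_of_nat_mult)
  define D where "D = (4 * ?a)\<^sup>2 * exp (6 * G)"
  \<comment> \<open>Squaring the count puts \<open>4 * G * K\<close> into the exponent. The constant
    \<open>1 / (8 * G)\<close> makes this at most \<open>4 * G + ln (2 * n) / 2\<close>, so the
    square is of order \<open>sqrt n\<close>.\<close>
  have "eventually (\<lambda>m. norm (s m) \<le> 1 / (8 * G) * norm (ln (real m))) at_top"
    using landau_o.smallD[OF s, of "1 / (8 * G)"] G by simp
  then obtain N where N: "\<And>m. m \<ge> N \<Longrightarrow> norm (s m) \<le> 1 / (8 * G) * norm (ln (real m))"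
    by (auto simp: eventually_at_top_linorder)
  \<comment> \<open>This size yields \<open>D * sqrt (2 * n) < n\<close> at the end.\<close>
  obtain n0 :: nat where "real n0 > 2 * D\<^sup>2" using reals_Archimedean2 by blast
  define n where "n = max 1 (max N n0)"
  have n: "n \<ge> 1" "2 * n \<ge> N" "real n > 2 * D\<^sup>2"
    using \<open>real n0 > 2 * D\<^sup>2\<close> by (auto simp: n_def)
  define K where "K = nat \<lfloor>max 1 (s (2 * n))\<rfloor>"
  have "real K \<le> max 1 (s (2 * n))" unfolding K_def by linarith
  also have "\<dots> \<le> 1 + ln (2 * real n) / (8 * G)"
  proof -
    have "ln (2 * real n) \<ge> 0" using n(1) by simp
    with N[OF n(2)] G show ?thesis by (auto simp: abs_le_iff)
  qed
  finally have K: "real K \<le> 1 + ln (2 * real n) / (8 * G)" .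
  define c where "c = card (boundary_configs M n K)"
  have "real c \<le> real (card (states M) * (2 * ((2 * K + 1) * card (work_alph M) ^ (2 * K + 1))))"
    unfolding c_def by (intro of_nat_mono boundary_configs_card(2) assms(2))
  also have "\<dots> = ?a * (2 * (real (2 * K + 1) * ?g ^ (2 * K + 1)))"
    by (simp only: of_nat_mult of_nat_power of_nat_numeral)
  also have "\<dots> \<le> ?a * (2 * (2 ^ (2 * K + 1) * ?g ^ (2 * K + 1)))"
    using a g less_imp_le[OF of_nat_less_two_power[of "2 * K + 1"]] by (intro mult_left_mono mult_right_mono) auto
  also have "\<dots> = 2 * ?a * exp (real (2 * K + 1) * G)"
    unfolding expG power_mult_distrib by (simp only: mult_ac)
  finally have "real c \<le> 2 * ?a * exp (real (2 * K + 1) * G)" .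
  moreover have "1 \<le> 2 * ?a * exp (real (2 * K + 1) * G)"
    using mult_mono[of 1 "2 * ?a" 1 "exp (real (2 * K + 1) * G)"] a G by simp
  ultimately have "real c + 1 \<le> 4 * ?a * exp (real (2 * K + 1) * G)" by linarith
  then have "(real c + 1)\<^sup>2 \<le> (4 * ?a * exp (real (2 * K + 1) * G))\<^sup>2"
    by (intro power_mono) auto
  also have "\<dots> = (4 * ?a)\<^sup>2 * exp (2 * (real (2 * K + 1) * G))"
    by (simp add: power_mult_distrib exp_double)
  also have "\<dots> \<le> (4 * ?a)\<^sup>2 * exp (6 * G + ln (2 * real n) / 2)"
  proof -
    have "4 * G * real K \<le> 4 * G * (1 + ln (2 * real n) / (8 * G))"
      using K G by (intro mult_left_mono) auto
    also have "\<dots> = 4 * G + ln (2 * real n) / 2" using G by (simp add: field_simps)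
    finally show ?thesis
      by (intro mult_left_mono) (auto simp: algebra_simps)
  qed
  also have "\<dots> = D * sqrt (2 * real n)"
    using n(1) by (simp add: D_def exp_add ln_sqrt[symmetric])
  also have "\<dots> < real n"
  proof -
    have "(D * sqrt (2 * real n))\<^sup>2 = 2 * D\<^sup>2 * real n"
      by (simp add: power_mult_distrib)
    also have "\<dots> < real n * real n"
      using n by (intro mult_strict_right_mono) auto
    also have "\<dots> = (real n)\<^sup>2"
      by (rule power2_eq_square[symmetric])
    finally show ?thesis
      by (rule power2_less_imp_less) simp
  qed
  also have "(real c + 1)\<^sup>2 = real ((c + 1)\<^sup>2)" by simp
  finally have "real ((c + 1)\<^sup>2) < real n" .
  then have "(c + 1)\<^sup>2 < n" by (simp only: of_nat_less_iff)
  then show ?thesis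
    unfolding c_def K_def by (rule that)
qed

theorem nonpalindromes_not_PTM_WOM:
  assumes s: "s \<in> o(\<lambda>n. ln (real n))"
  shows "nonpalindromes \<notin> PTM_WOM_pos_one_sided s {0, 1}"
proof
  assume "nonpalindromes \<in> PTM_WOM_pos_one_sided s {0, 1}"
  then obtain M where M: "wom_free M" "ptm_wom_ok {0, 1} M" "ptm_uses_space {0, 1} s M"
    "recognizes_pos_one_sided {0, 1} (ptm_accept_prob M) nonpalindromes"
    by (rule wom_free_wlog)
  have acc: "ptm_reaches_accept M w \<longleftrightarrow> w \<in> nonpalindromes" if "w \<in> lists {0, 1}" for w
  proof -
    from M(4) obtain p where "0 < p"
      and p: "\<forall>w\<in>lists {0, 1}. (w \<in> nonpalindromes \<longrightarrow> ptm_accept_prob M w \<ge> p) \<and>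
        (w \<notin> nonpalindromes \<longrightarrow> ptm_accept_prob M w = 0)"
      unfolding recognizes_pos_one_sided_def by (elim exE conjE)
    from bspec[OF p that] \<open>0 < p\<close> have "0 < ptm_accept_prob M w \<longleftrightarrow> w \<in> nonpalindromes"
      by (cases "w \<in> nonpalindromes") simp_all
    then show ?thesis
      by (simp only: accept_prob_pos_iff)
  qed
  have frame: "frame_ok M" using M(2) by (simp add: ptm_wom_ok_def)
  obtain n where n: "n > (card (boundary_configs M n (nat \<lfloor>max 1 (s (2 * n))\<rfloor>)) + 1)\<^sup>2"
    using length_with_few_configs[OF s frame] .
  define K where "K = nat \<lfloor>max 1 (s (2 * n))\<rfloor>"
  obtain x x' where x: "x \<in> lists {0, 1}" "x' \<in> lists {0, 1}" "length x = n" "length x' = n" "x \<noteq> x'"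
    and eq: "crossing M (boundary_configs M n K) x = crossing M (boundary_configs M n K) x'"
    using crossing_collision[OF frame n] unfolding K_def .
  have lists: "x' @ rev x \<in> lists {0, 1}" "x @ rev x \<in> lists {0, 1}"
    using x(1,2) by (simp_all add: lists_eq_set)
  have "rev (x' @ rev x) \<noteq> x' @ rev x"
    using x(3-5) by simp
  with lists have "x' @ rev x \<in> nonpalindromes" "x @ rev x \<notin> nonpalindromes"
    by (simp_all add: nonpalindromes_def)
  moreover have "ptm_reaches_accept M (x @ rev x)" if "ptm_reaches_accept M (x' @ rev x)"
  proof (rule crossing_transfer[OF _ eq _ that])
    fix c assume c: "(ptm_move M (x' @ rev x))\<^sup>*\<^sup>* (init_config M) c"
      "input_pos c \<in> {int (length x), int (length x) + 1}"
    have bound: "max 1 (s (length (x' @ rev x))) < real K + 1"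
      unfolding K_def length_append length_rev x(3,4) mult_2[symmetric] by linarith
    show "c \<in> boundary_configs M n K"
      using reachable_in_boundary[OF M(2,1,3) lists(1) c(1) bound c(2)] unfolding x(3) .
  qed (use x in simp)
  ultimately show False using acc[OF lists(1)] acc[OF lists(2)] by blast
qed

section \<open>A quantum machine for the non-palindromes\<close>

text \<open>
  States 0 and 1 move right, states 2 and 3 move left; the parity of the state distinguishes the two
  branches of the superposition.  The even branch copies the input to the memory while moving right,
  the odd one while moving left.
\<close>

definition goes_left :: "nat \<Rightarrow> insym \<Rightarrow> bool" where
  "goes_left q \<sigma> \<longleftrightarrow> 2 \<le> q \<or> \<sigma> = RightEnd"

definition head_move :: "nat \<Rightarrow> insym \<Rightarrow> move" where
  "head_move q \<sigma> = (if \<not> goes_left q \<sigma> then MoveRight else if \<sigma> = LeftEnd then Stay else MoveLeft)"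

definition copies :: "nat \<Rightarrow> insym \<Rightarrow> bool" where
  "copies q \<sigma> \<longleftrightarrow> \<sigma> \<noteq> LeftEnd \<and> \<sigma> \<noteq> RightEnd \<and> (even q \<longleftrightarrow> q < 2)"

definition flips :: "nat \<Rightarrow> insym \<Rightarrow> bool" where
  "flips q \<sigma> \<longleftrightarrow> copies q \<sigma> \<and> \<sigma> \<noteq> Letter 0"

text \<open>The memory head moves right in both branches, so \<open>rev w\<close> is laid on the
  same squares as \<open>w\<close>, and both heads end on square \<open>length w\<close>.\<close>

definition mem_move :: "nat \<Rightarrow> insym \<Rightarrow> move" where
  "mem_move q \<sigma> = (if copies q \<sigma> then MoveRight else Stay)"

text \<open>
  The register symbol tells the direction, the scanned symbol and an outcome bit, but not the branch.
  The outcome is only nontrivial on the left end-marker, where a two-outcome gate splits the initial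
  state into the branches and finally compares them.
\<close>

type_synonym observation = "bool \<times> insym \<times> bool"

text \<open>Let \<open>+\<close> and \<open>-\<close> be the normalized sum and difference of the
  even and the odd state of one direction. On the left end-marker, outcome \<open>False\<close> is
  the operator \<open>|+><+|\<close> and outcome \<open>True\<close> is \<open>|+><-|\<close>; so
  equal amplitudes on both states never yield \<open>True\<close>. In this form all entries are
  halves, without square roots.\<close>

definition local_amp :: "nat \<Rightarrow> insym \<Rightarrow> nat \<Rightarrow> observation \<Rightarrow> complex" where
  "local_amp q \<sigma> q' = (\<lambda>(g, \<tau>, e).
     if g = (2 \<le> q) \<and> \<tau> = \<sigma> \<and> (2 \<le> q') = goes_left q \<sigma> then
       if \<sigma> = LeftEnd then if e \<and> odd q then -1/2 else 1/2
       else if \<not> e \<and> odd q' = odd q then 1 else 0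
     else 0)"

text \<open>
  Writing a fixed symbol is not reversible, but the superposition of the three writing actions with
  these amplitudes maps the bit under the head to its complement.
\<close>

definition mem_amp :: "bool \<Rightarrow> nat \<Rightarrow> complex" where
  "mem_amp f g = (if f then if g = 2 then -1 else 1 else if g = 2 then 1 else 0)"

abbreviation observations :: "observation set" where
  "observations \<equiv> UNIV \<times> insyms {0, 1} \<times> UNIV"

text \<open>The final comparison ends the run with either outcome. Outcome \<open>True\<close> of
  the initial gate is given up too, at the price of half the probability, to leave a single
  surviving history.\<close>

definition halting :: "observation set" where
  "halting = {(True, LeftEnd, True), (True, LeftEnd, False), (False, LeftEnd, True)}"

definition nonpal_qtm :: qtm_wom where
  "nonpal_qtm =
     \<lparr> states = {..<4}, start = 0, work_alph = {0}, work_blank = 0,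
       wom_alph = {0, 1, 2}, wom_blank = 0, wom_empty = 2,
       accept_syms = {to_nat (True, LeftEnd, True)},
       reject_syms = {to_nat (True, LeftEnd, False), to_nat (False, LeftEnd, True)},
       continue_syms = to_nat ` (observations - halting),
       amplitude = (\<lambda>q \<sigma> \<gamma> a \<omega>.
         if a = Action (new_state a) \<gamma> (head_move q \<sigma>) Stay (wom_write a) (mem_move q \<sigma>)
         then local_amp q \<sigma> (new_state a) (from_nat \<omega>) * mem_amp (flips q \<sigma>) (wom_write a)
         else 0) \<rparr>"

section \<open>Well-formedness and space of the quantum machine\<close>

lemma nonpal_qtm_simps [simp]:
  "states nonpal_qtm = {..<4}" "start nonpal_qtm = 0" "work_alph nonpal_qtm = {0}"
  "work_blank nonpal_qtm = 0" "wom_alph nonpal_qtm = {0, 1, 2}" "wom_blank nonpal_qtm = 0"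
  "wom_empty nonpal_qtm = 2" "accept_syms nonpal_qtm = {to_nat (True, LeftEnd, True)}"
  "continue_syms nonpal_qtm = to_nat ` (observations - halting)"
  by (simp_all add: nonpal_qtm_def)

lemma register_nonpal_qtm: "register_syms nonpal_qtm = to_nat ` observations"
  by (auto simp: register_syms_def nonpal_qtm_def halting_def insyms_def)

lemma sum_register_nonpal_qtm:
  "(\<Sum>\<omega>\<in>register_syms nonpal_qtm. f (from_nat \<omega>)) = (\<Sum>x\<in>observations. f x)"
  unfolding register_nonpal_qtm by (subst sum.reindex) (auto intro: inj_on_subset[OF inj_to_nat])

text \<open>The finite core of well-formedness: apart from states and observations, a step is an
  injective change of head positions and memory.\<close>

lemma local_amp_orthonormal:
  assumes "q < 4" "p < 4" "\<sigma> \<in> insyms {0, 1}"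
  shows "(\<Sum>x\<in>observations. \<Sum>q'<4. cnj (local_amp q \<sigma> q' x) * local_amp p \<tau> q' x) =
    (if q = p \<and> \<sigma> = \<tau> then 1 else 0)"
proof (cases "(2 \<le> q) = (2 \<le> p) \<and> \<sigma> = \<tau>")
  case False
  then have "cnj (local_amp q \<sigma> q' x) * local_amp p \<tau> q' x = 0" for q' x
    by (auto simp: local_amp_def split: prod.split)
  then have "(\<Sum>x\<in>observations. \<Sum>q'<4. cnj (local_amp q \<sigma> q' x) * local_amp p \<tau> q' x) = 0"
    by (simp only: sum.neutral_const)
  with False show ?thesis by auto
next
  case True
  let ?f = "\<lambda>x. \<Sum>q'<4. cnj (local_amp q \<sigma> q' x) * local_amp p \<tau> q' x"
  have "sum ?f observations = sum ?f {(2 \<le> q, \<sigma>, False), (2 \<le> q, \<sigma>, True)}"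
  proof (rule sum.mono_neutral_right)
    show "\<forall>x\<in>observations - {(2 \<le> q, \<sigma>, False), (2 \<le> q, \<sigma>, True)}. ?f x = 0"
    proof
      fix x assume x: "x \<in> observations - {(2 \<le> q, \<sigma>, False), (2 \<le> q, \<sigma>, True)}"
      obtain g \<tau>' e where "x = (g, \<tau>', e)" by (cases x)
      with x have "g \<noteq> (2 \<le> q) \<or> \<tau>' \<noteq> \<sigma>" by (cases e) auto
      then have "local_amp q \<sigma> q' x = 0" for q'
        by (simp add: local_amp_def \<open>x = _\<close>) blast
      then show "?f x = 0" by simp
    qed
  qed (use assms(3) in \<open>auto simp: insyms_def\<close>)
  moreover have "sum ?f {(2 \<le> q, \<sigma>, False), (2 \<le> q, \<sigma>, True)} = (if q = p \<and> \<sigma> = \<tau> then 1 else 0)"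
  proof -
    define L where "L = goes_left q \<sigma>"
    \<comment> \<open>\<open>lam\<close> sees the old state only through its parity and through
      \<open>L\<close>, which leaves a small case check.\<close>
    define lam :: "bool \<Rightarrow> nat \<Rightarrow> bool \<Rightarrow> complex" where "lam = (\<lambda>o' q' e.
      if (2 \<le> q') = L then
        if \<sigma> = LeftEnd then if e \<and> o' then -1/2 else 1/2 else if \<not> e \<and> odd q' = o' then 1 else 0
      else 0)"
    have amp: "local_amp q \<sigma> q' (2 \<le> q, \<sigma>, e) = lam (odd q) q' e"
        "local_amp p \<tau> q' (2 \<le> q, \<sigma>, e) = lam (odd p) q' e" for q' e
    proof -
      have "goes_left q \<sigma> = L" "goes_left p \<tau> = L"
        using True by (simp_all add: L_def goes_left_def)
      with True show "local_amp q \<sigma> q' (2 \<le> q, \<sigma>, e) = lam (odd q) q' e"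
          "local_amp p \<tau> q' (2 \<le> q, \<sigma>, e) = lam (odd p) q' e"
        by (simp_all only: local_amp_def lam_def prod.case simp_thms if_True)
    qed
    have four: "(\<Sum>q'<4. h q') = h 0 + h 1 + h 2 + h 3" for h :: "nat \<Rightarrow> complex"
      by (simp add: eval_nat_numeral)
    have eq: "q = p \<longleftrightarrow> odd q = odd p"
    proof -
      have "q \<in> {0, 1} \<and> p \<in> {0, 1} \<or> q \<in> {2, 3} \<and> p \<in> {2, 3}" using assms True by auto
      then show ?thesis by auto
    qed
    have "sum ?f {(2 \<le> q, \<sigma>, False), (2 \<le> q, \<sigma>, True)} =
        (\<Sum>q'<4. cnj (lam (odd q) q' False) * lam (odd p) q' False) +
        (\<Sum>q'<4. cnj (lam (odd q) q' True) * lam (odd p) q' True)"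
      by (simp add: amp)
    also have "\<dots> = (if odd q = odd p then 1 else 0)"
      unfolding four lam_def by (cases L; cases "\<sigma> = LeftEnd"; cases "odd q"; cases "odd p") simp_all
    finally show ?thesis using True by (simp add: eq)
  qed
  ultimately show ?thesis by simp
qed

definition mem_next :: "nat list \<Rightarrow> config \<Rightarrow> nat \<Rightarrow> config" where
  "mem_next w c q' = \<lparr> state = q',
     input_pos = shift (head_move (state c) (scanned_input w c)) (input_pos c),
     work_pos = work_pos c, work_tape = work_tape c,
     wom_pos = shift (mem_move (state c) (scanned_input w c)) (wom_pos c),
     wom_tape = (if flips (state c) (scanned_input w c)
       then (wom_tape c)(wom_pos c := 1 - wom_tape c (wom_pos c)) else wom_tape c) \<rparr>"

lemma nonpal_config_bits:
  assumes "c \<in> configs nonpal_qtm w"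
  shows "wom_tape c i = 0 \<or> wom_tape c i = 1" "work_tape c i = 0"
proof -
  have "range (wom_tape c) \<subseteq> {0, 1, 2} - {2}" "range (work_tape c) \<subseteq> {0}"
    using assms by (simp_all add: configs_def)
  then have "wom_tape c i \<in> {0, 1, 2} - {2}" "work_tape c i \<in> {0}" by blast+
  then show "wom_tape c i = 0 \<or> wom_tape c i = 1" "work_tape c i = 0" by auto
qed

lemma mem_next_in_configs:
  assumes c: "c \<in> configs nonpal_qtm w" and "q' < 4"
  shows "mem_next w c q' \<in> configs nonpal_qtm w"
proof -
  have pos: "0 \<le> input_pos (mem_next w c q') \<and> input_pos (mem_next w c q') \<le> int (length w) + 1"
    using c by (auto simp: configs_def scanned_input_def head_move_def goes_left_def input_at_def mem_next_def)
  have "finite {i. (f(p := x)) i \<noteq> 0}" if "finite {i. f i \<noteq> 0}" for f :: "int \<Rightarrow> nat" and p x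
    by (rule finite_subset[of _ "insert p {i. f i \<noteq> 0}"]) (use that in auto)
  moreover have "wom_tape (mem_next w c q') i = 0 \<or> wom_tape (mem_next w c q') i = 1" for i
    using nonpal_config_bits(1)[OF c] by (auto simp: mem_next_def)
  then have "wom_tape (mem_next w c q') i \<in> {0, 1, 2} - {2}" for i
    by (metis DiffI empty_iff insert_iff one_eq_numeral_iff semiring_norm(85) zero_neq_numeral)
  then have range: "range (wom_tape (mem_next w c q')) \<subseteq> {0, 1, 2} - {2}"
    by (rule image_subsetI)
  ultimately have fin: "finite {i. wom_tape (mem_next w c q') i \<noteq> 0}"
    using c by (auto simp: configs_def mem_next_def simp del: fun_upd_apply)
  have work: "work_tape (mem_next w c q') i = 0" for i
    using nonpal_config_bits(2)[OF c] by (simp add: mem_next_def)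
  show ?thesis
    unfolding configs_def mem_Collect_eq nonpal_qtm_simps
    using pos range fin \<open>q' < 4\<close> by (intro conjI) (auto simp: work, auto simp: mem_next_def)
qed

text \<open>Rewriting the old bit and writing the empty symbol lead to the same configuration, so
  their amplitudes add. In a flip these are 1 and -1 and cancel, and only the complemented bit
  survives; hence there is one target for each new state.\<close>

lemma step_amp_nonpal:
  assumes c: "c \<in> configs nonpal_qtm w"
  shows "step_amp nonpal_qtm w \<omega> d c =
    (if state d < 4 \<and> d = mem_next w c (state d)
     then local_amp (state c) (scanned_input w c) (state d) (from_nat \<omega>) else 0)"
proof -
  let ?q = "state c" and ?\<sigma> = "scanned_input w c"
  let ?amp = "\<lambda>a. amplitude nonpal_qtm ?q ?\<sigma> (scanned_work c) a \<omega>"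
  let ?A = "\<lambda>g. Action (state d) 0 (head_move ?q ?\<sigma>) Stay g (mem_move ?q ?\<sigma>)"
  let ?S = "{a \<in> actions nonpal_qtm. perform nonpal_qtm a c = d}"
  have work: "scanned_work c = 0"
    using nonpal_config_bits[OF c] by (simp add: scanned_work_def)
  have frame: "frame_ok nonpal_qtm" by (simp add: frame_ok_def)
  have zero: "?amp a = 0" if "a \<in> ?S" "a \<notin> ?A ` {0, 1, 2}" for a
  proof (rule ccontr)
    assume "?amp a \<noteq> 0"
    then have "a = Action (new_state a) 0 (head_move ?q ?\<sigma>) Stay (wom_write a) (mem_move ?q ?\<sigma>)"
      by (auto simp: nonpal_qtm_def work split: if_splits)
    moreover have "new_state a = state d" "wom_write a \<in> {0, 1, 2}"
      using that(1) by (auto simp: perform_def actions_def)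
    ultimately show False using that(2) by (metis imageI)
  qed
  have "step_amp nonpal_qtm w \<omega> d c = sum ?amp ?S"
    by (simp add: step_amp_def)
  also have "\<dots> = sum ?amp (?S \<inter> ?A ` {0, 1, 2})"
    using finite_actions[OF frame] zero by (intro sum.mono_neutral_right) auto
  also have "\<dots> = (\<Sum>a\<in>?A ` {0, 1, 2}. if a \<in> ?S then ?amp a else 0)"
    by (subst Int_commute) (rule sum.inter_restrict, simp)
  also have "\<dots> = (\<Sum>g\<in>{0, 1, 2}. if ?A g \<in> ?S then ?amp (?A g) else 0)"
    by (subst sum.reindex) (auto simp: inj_on_def)
  also have "\<dots> = (\<Sum>g\<in>{0, 1, 2}. if state d < 4 \<and> perform nonpal_qtm (?A g) c = d
      then local_amp ?q ?\<sigma> (state d) (from_nat \<omega>) * mem_amp (flips ?q ?\<sigma>) g else 0)"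
    by (intro sum.cong refl) (auto simp: actions_def work, auto simp: nonpal_qtm_def)
  also have "\<dots> = (if state d < 4 \<and> d = mem_next w c (state d)
     then local_amp ?q ?\<sigma> (state d) (from_nat \<omega>) else 0)"
  proof -
    have "(work_tape c)(work_pos c := 0) = work_tape c"
      using nonpal_config_bits[OF c] by auto
    then have perform: "perform nonpal_qtm (?A g) c = d \<longleftrightarrow>
        mem_next w c (state d)\<lparr>wom_tape := if g = 2 then wom_tape c else (wom_tape c)(wom_pos c := g)\<rparr> = d" for g
      by (simp add: perform_def mem_next_def)
    define m where "m = mem_next w c (state d)"
    have m: "wom_tape m = (if flips ?q ?\<sigma>
       then (wom_tape c)(wom_pos c := 1 - wom_tape c (wom_pos c)) else wom_tape c)"
      by (simp add: m_def mem_next_def)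
    \<comment> \<open>\<open>P\<close> says that \<open>d\<close> agrees with \<open>m\<close>
      outside the memory tape, so that only memory tapes remain to be compared.\<close>
    define P where "P \<longleftrightarrow> m\<lparr>wom_tape := wom_tape d\<rparr> = d"
    have upd: "m\<lparr>wom_tape := T\<rparr> = d \<longleftrightarrow> P \<and> T = wom_tape d" for T
      unfolding P_def by (cases m; cases d) auto
    have m_eq: "d = m \<longleftrightarrow> P \<and> wom_tape m = wom_tape d"
      unfolding P_def by (cases m; cases d) auto
    let ?x = "wom_tape c (wom_pos c)"
    have x: "?x = 0 \<or> ?x = 1" using nonpal_config_bits[OF c] by simp
    have idem: "(wom_tape c)(wom_pos c := ?x) = wom_tape c" by simp
    have neq: "(wom_tape c)(wom_pos c := 1 - ?x) \<noteq> wom_tape c"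
      using x by (auto simp: fun_eq_iff)
    show ?thesis
      unfolding perform m_def[symmetric] upd m_eq m
      using x idem neq by (elim disjE) (auto simp: mem_amp_def)
  qed
  finally show ?thesis .
qed

lemma mem_next_inj:
  assumes "c \<in> configs nonpal_qtm w" "c' \<in> configs nonpal_qtm w"
    and eq: "state c = state c'" "scanned_input w c = scanned_input w c'"
      "mem_next w c q' = mem_next w c' q'"
  shows "c = c'"
proof -
  have shift_inj: "shift m i = shift m j \<longleftrightarrow> i = j" for m i j by (cases m) auto
  have pos: "input_pos c = input_pos c'" "work_pos c = work_pos c'" "wom_pos c = wom_pos c'"
      "work_tape c = work_tape c'"
    using eq by (auto simp: mem_next_def shift_inj)
  have "wom_tape c i = wom_tape c' i" for i
  proof -
    have "wom_tape (mem_next w c q') i = wom_tape (mem_next w c' q') i" using eq by simp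
    then show ?thesis
      using nonpal_config_bits(1)[OF assms(1), of i] nonpal_config_bits(1)[OF assms(2), of i] eq(1,2) pos
      by (auto simp: mem_next_def split: if_splits)
  qed
  with pos eq show ?thesis by (auto simp: fun_eq_iff intro!: config.equality)
qed

lemma well_formed_nonpal: "well_formed {0, 1} nonpal_qtm"
  unfolding well_formed_def
proof (intro ballI)
  fix w c c'
  assume w: "w \<in> lists {0::nat, 1}" and c: "c \<in> configs nonpal_qtm w" and c': "c' \<in> configs nonpal_qtm w"
  let ?E = "\<lambda>\<omega> d c. step_amp nonpal_qtm w \<omega> d c"
  \<comment> \<open>The new state does not affect whether the two images agree, so \<open>R\<close>
    factors out of the sum over \<open>q'\<close>.\<close>
  define R where "R \<longleftrightarrow> mem_next w c 0 = mem_next w c' 0"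
  let ?l = "\<lambda>c. local_amp (state c) (scanned_input w c)"
  have R: "mem_next w c q = mem_next w c' q \<longleftrightarrow> R" for q by (simp add: mem_next_def R_def)
  have inner: "(\<Sum>\<^sub>\<infinity>d\<in>configs nonpal_qtm w. cnj (?E \<omega> d c) * ?E \<omega> d c') =
      (\<Sum>q'<4. cnj (?l c q' (from_nat \<omega>)) * (if R then ?l c' q' (from_nat \<omega>) else 0))" for \<omega>
  proof -
    have state: "state (mem_next w c q) = q" for q by (simp add: mem_next_def)
    have "(\<Sum>\<^sub>\<infinity>d\<in>configs nonpal_qtm w. cnj (?E \<omega> d c) * ?E \<omega> d c') =
        (\<Sum>d\<in>mem_next w c ` {..<4}. cnj (?E \<omega> d c) * ?E \<omega> d c')"
    proof (rule infsum_finite_support)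
      fix d assume "d \<in> configs nonpal_qtm w - mem_next w c ` {..<4}"
      then have "\<not> (state d < 4 \<and> d = mem_next w c (state d))" by auto
      then have "?E \<omega> d c = 0" unfolding step_amp_nonpal[OF c] by (rule if_not_P)
      then show "cnj (?E \<omega> d c) * ?E \<omega> d c' = 0" by simp
    qed (auto intro: mem_next_in_configs c)
    also have "\<dots> = (\<Sum>q'<4. cnj (?E \<omega> (mem_next w c q') c) * ?E \<omega> (mem_next w c q') c')"
      by (subst sum.reindex) (auto intro: inj_on_inverseI[where g = state] state)
    also have "\<dots> = (\<Sum>q'<4. cnj (?l c q' (from_nat \<omega>)) * (if R then ?l c' q' (from_nat \<omega>) else 0))"
      by (intro sum.cong refl) (simp add: step_amp_nonpal c c' state R)
    finally show ?thesis .
  qed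
  have "(\<Sum>\<omega>\<in>register_syms nonpal_qtm. \<Sum>\<^sub>\<infinity>d\<in>configs nonpal_qtm w. cnj (?E \<omega> d c) * ?E \<omega> d c') =
      (\<Sum>x\<in>observations. \<Sum>q'<4. cnj (?l c q' x) * (if R then ?l c' q' x else 0))"
    unfolding inner by (rule sum_register_nonpal_qtm)
  also have "\<dots> = (if R then (if state c = state c' \<and> scanned_input w c = scanned_input w c' then 1 else 0) else 0)"
    using local_amp_orthonormal[of "state c" "state c'" "scanned_input w c" "scanned_input w c'"]
      scanned_in[OF c w] scanned_in[OF c' w] by simp
  also have "\<dots> = (if c = c' then 1 else 0)"
    using mem_next_inj[OF c c', of 0] by (auto simp: R_def)
  finally show "(\<Sum>\<omega>\<in>register_syms nonpal_qtm. \<Sum>\<^sub>\<infinity>d\<in>configs nonpal_qtm w.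
      cnj (?E \<omega> d c) * ?E \<omega> d c') = (if c = c' then 1 else 0)" .
qed

lemma nonpal_qtm_ok: "qtm_wom_ok {0, 1} nonpal_qtm"
proof -
  have "amplitude nonpal_qtm q \<sigma> \<gamma> a \<omega> \<in> {0, 1, -1, 1/2, -1/2}" for q \<sigma> \<gamma> a \<omega>
    by (cases "from_nat \<omega> :: observation") (auto simp: nonpal_qtm_def local_amp_def mem_amp_def)
  then have "efficiently_computable (amplitude nonpal_qtm q \<sigma> \<gamma> a \<omega>)" for q \<sigma> \<gamma> a \<omega>
    by (rule efficiently_computable_half_multiples)
  moreover have "respects_ends \<sigma> a" if "amplitude nonpal_qtm q \<sigma> \<gamma> a \<omega> \<noteq> 0" for q \<sigma> \<gamma> a \<omega>
  proof -
    have "input_move a = head_move q \<sigma>"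
      using that by (auto simp: nonpal_qtm_def split: if_splits) (metis action.sel(3))
    then show ?thesis by (auto simp: respects_ends_def head_move_def goes_left_def)
  qed
  moreover have "finite (register_syms nonpal_qtm)"
    unfolding register_nonpal_qtm by (auto simp: insyms_def)
  moreover have "frame_ok nonpal_qtm" by (simp add: frame_ok_def)
  moreover have "accept_syms nonpal_qtm \<inter> reject_syms nonpal_qtm = {}"
    "accept_syms nonpal_qtm \<inter> continue_syms nonpal_qtm = {}"
    "reject_syms nonpal_qtm \<inter> continue_syms nonpal_qtm = {}"
    by (auto simp: nonpal_qtm_def halting_def)
  ultimately show ?thesis
    using well_formed_nonpal by (simp only: qtm_wom_ok_def) blast
qed

lemma nonpal_qtm_space: "qtm_uses_space \<Sigma> s nonpal_qtm"
proof -
  have move: "work_pos d = work_pos c" if "step_amp nonpal_qtm w \<omega> d c \<noteq> 0" for w \<omega> d c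
  proof -
    have "\<exists>a. perform nonpal_qtm a c = d \<and>
        amplitude nonpal_qtm (state c) (scanned_input w c) (scanned_work c) a \<omega> \<noteq> 0"
      using that unfolding step_amp_def by (auto elim!: sum.not_neutral_contains_not_neutral)
    then obtain a where "perform nonpal_qtm a c = d"
      "amplitude nonpal_qtm (state c) (scanned_input w c) (scanned_work c) a \<omega> \<noteq> 0"
      by blast
    moreover from this(2) have "work_move a = Stay"
      by (auto simp: nonpal_qtm_def split: if_splits) (metis action.sel(4))
    ultimately show ?thesis by (auto simp: perform_def)
  qed
  have "work_pos ` set cs = {0}" if "qtm_path nonpal_qtm w halted cs" for w halted cs
    using that
  proof (induction rule: qtm_path.induct)
    case qtm_path_init
    show ?case by (simp add: init_config_def)
  next
    case (qtm_path_step c cs \<omega> d)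
    then show ?case using move[OF qtm_path_step.hyps(3)] by auto
  qed
  then show ?thesis by (simp add: qtm_uses_space_def within_space_def)
qed

section \<open>The two branches and their interference\<close>

lemma qtm_state_zero: "qtm_state M w h = (\<lambda>_. 0) \<Longrightarrow> qtm_state M w (\<omega> # h) = (\<lambda>_. 0)"
  by (simp add: fun_eq_iff)

lemma qtm_state_two_points:
  assumes "c0 \<in> configs M w" "c1 \<in> configs M w" "c0 \<noteq> c1"
    and "qtm_state M w h = (\<lambda>d. if d = c0 \<or> d = c1 then 1/2 else 0)"
  shows "qtm_state M w (\<omega> # h) d = (step_amp M w \<omega> d c0 + step_amp M w \<omega> d c1) / 2"
proof -
  have "qtm_state M w (\<omega> # h) d = (\<Sum>c\<in>{c0, c1}. step_amp M w \<omega> d c * qtm_state M w h c)"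
    unfolding qtm_state.simps using assms by (intro infsum_finite_support) auto
  also have "\<dots> = (step_amp M w \<omega> d c0 + step_amp M w \<omega> d c1) / 2"
    using assms(3) by (simp add: assms(4))
  finally show ?thesis .
qed

text \<open>Zero is both a letter and the blank, so a word can be recovered from the tape only if
  its length is known; hence the condition in \<open>tape_of_inj\<close>.\<close>

definition tape_of :: "nat list \<Rightarrow> int \<Rightarrow> nat" where
  "tape_of v i = (if 0 \<le> i \<and> i < int (length v) then v ! nat i else 0)"

lemma tape_of_snoc: "tape_of (v @ [a]) = (tape_of v)(int (length v) := a)"
  by (auto simp: tape_of_def fun_eq_iff nth_append)

lemma tape_of_inj: "length v = length v' \<Longrightarrow> tape_of v = tape_of v' \<Longrightarrow> v = v'"
  by (rule nth_equalityI) (simp_all add: tape_of_def fun_eq_iff, metis nat_int of_nat_0_le_iff of_nat_less_iff)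

definition conf :: "nat \<Rightarrow> nat \<Rightarrow> nat \<Rightarrow> nat list \<Rightarrow> config" where
  "conf q i p v = \<lparr> state = q, input_pos = int i, work_pos = 0, work_tape = (\<lambda>_. 0),
     wom_pos = int p, wom_tape = tape_of v \<rparr>"

lemma conf_simps [simp]:
  "state (conf q i p v) = q" "input_pos (conf q i p v) = int i"
  "conf q i p v = conf q' i' p' v' \<longleftrightarrow> q = q' \<and> i = i' \<and> p = p' \<and> tape_of v = tape_of v'"
  by (auto simp: conf_def)

lemma nth_bit: "set v \<subseteq> {0, 1} \<Longrightarrow> i < length v \<Longrightarrow> v ! i \<in> {0, 1}"
  by (rule subsetD[OF _ nth_mem])

lemma conf_in_configs:
  assumes "q < 4" "i \<le> length w + 1" "set v \<subseteq> {0, 1}"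
  shows "conf q i p v \<in> configs nonpal_qtm w"
proof -
  have "tape_of v j \<in> {0, 1}" for j
    using nth_bit[OF assms(3), of "nat j"] by (auto simp: tape_of_def)
  then have "tape_of v j \<in> {0, 1, 2} - {2}" for j
    by (metis DiffI empty_iff insert_iff one_eq_numeral_iff semiring_norm(85) zero_neq_numeral)
  then have "range (tape_of v) \<subseteq> {0, 1, 2} - {2}"
    by (rule image_subsetI)
  moreover have "finite {j. tape_of v j \<noteq> 0}"
    by (rule finite_subset[of _ "{0..<int (length v)}"]) (auto simp: tape_of_def)
  ultimately show ?thesis
    using assms by (auto simp: configs_def conf_def)
qed

lemma mem_next_conf_copy:
  assumes "copies q (input_at w (int i))" "input_at w (int i) = Letter a" "a \<in> {0, 1}" "length v = p"
  shows "mem_next w (conf q i p v) q' = conf q' (if q < 2 then i + 1 else i - 1) (p + 1) (v @ [a])"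
proof -
  have "i > 0" using assms(2) by (auto simp: input_at_def split: if_splits)
  \<comment> \<open>The square is still blank, that is 0: flipping it writes the letter 1, leaving
    it writes the letter 0.\<close>
  moreover have "tape_of v (int p) = 0" using assms(4) by (simp add: tape_of_def)
  moreover have "(tape_of v)(int p := 0) = tape_of v" using calculation by auto
  ultimately show ?thesis
    using assms by (auto simp: mem_next_def conf_def scanned_input_def head_move_def goes_left_def
        mem_move_def flips_def tape_of_snoc copies_def)
qed

text \<open>A left-going state stays on the left end-marker, which agrees with \<open>i - 1\<close>
  for \<open>i = 0\<close> by truncated subtraction.\<close>

lemma mem_next_conf_skip:
  assumes "\<not> copies q (input_at w (int i))"
  shows "mem_next w (conf q i p v) q' =
    conf q' (if goes_left q (input_at w (int i)) then i - 1 else i + 1) p v"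
  using assms
  by (auto simp: mem_next_def conf_def scanned_input_def head_move_def goes_left_def mem_move_def
      flips_def input_at_def)

context
  fixes w :: "nat list"
  assumes w: "w \<in> lists {0, 1}"
begin

text \<open>The timetable: square \<open>t\<close> is scanned at time \<open>t\<close> up to the
  right end-marker at time \<open>length w + 1\<close>; the way back begins at time
  \<open>length w + 2\<close> on square \<open>length w\<close> and reaches the left end-marker at
  time \<open>2 * length w + 2\<close>.\<close>

definition turned :: "nat \<Rightarrow> bool" where
  "turned t \<longleftrightarrow> length w + 2 \<le> t"

definition position :: "nat \<Rightarrow> nat" where
  "position t = (if turned t then 2 * length w + 2 - t else t)"

definition branch :: "bool \<Rightarrow> nat \<Rightarrow> config" where
  "branch \<beta> t = (if \<beta>
     then conf (if turned t then 3 else 1) (position t) (t - (length w + 2)) (take (t - (length w + 2)) (rev w))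
     else conf (if turned t then 2 else 0) (position t) (min (t - 1) (length w)) (take (t - 1) w))"

text \<open>Independent of the branch, which is why observing the register leaves the superposition
  intact.\<close>

definition observed :: "nat \<Rightarrow> observation" where
  "observed t = (turned t, input_at w (int (position t)), False)"

fun observed_history :: "nat \<Rightarrow> nat list" where
  "observed_history 0 = []"
| "observed_history (Suc t) = to_nat (observed t) # observed_history t"

lemma letters: "set w \<subseteq> {0, 1}"
  using w by (auto simp: in_lists_conv_set)

lemma branch_in_configs: "t \<le> 2 * length w + 2 \<Longrightarrow> branch \<beta> t \<in> configs nonpal_qtm w"
  using letters set_take_subset[of "t - 1" w] set_take_subset[of "t - (length w + 2)" "rev w"]
  by (auto simp: branch_def position_def turned_def intro!: conf_in_configs)

lemma state_branch: "state (branch \<beta> t) = (if turned t then 2 else 0) + (if \<beta> then 1 else 0)"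
  by (simp add: branch_def)

lemma scanned_branch: "scanned_input w (branch \<beta> t) = input_at w (int (position t))"
  by (simp add: branch_def scanned_input_def)

lemma branch_next:
  assumes "1 \<le> t" "t \<le> 2 * length w + 1"
  shows "mem_next w (branch \<beta> t) (state (branch \<beta> (Suc t))) = branch \<beta> (Suc t)"
proof -
  let ?n = "length w"
  consider "t \<le> ?n" | "t = ?n + 1" | "?n + 2 \<le> t" by linarith
  then show ?thesis
  proof cases
    case 1
    have \<sigma>: "input_at w (int t) = Letter (w ! (t - 1))"
      using 1 assms by (auto simp: input_at_def nat_diff_distrib)
    have a: "w ! (t - 1) \<in> {0, 1}" using 1 assms by (intro nth_bit letters) simp
    have take: "take t w = take (t - 1) w @ [w ! (t - 1)]"
      using 1 assms take_Suc_conv_app_nth[of "t - 1" w] by simp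
    show ?thesis
    proof (cases \<beta>)
      case True
      have "\<not> copies 1 (input_at w (int t))" by (simp add: copies_def)
      from mem_next_conf_skip[OF this] True 1 \<sigma> show ?thesis
        by (simp add: branch_def turned_def position_def goes_left_def)
    next
      case False
      have "copies 0 (input_at w (int t))" by (simp add: copies_def \<sigma>)
      from mem_next_conf_copy[OF this \<sigma> a, of "take (t - 1) w" "t - 1"] False 1 assms take show ?thesis
        by (simp add: branch_def turned_def position_def min_absorb1)
    qed
  next
    case 2
    have \<sigma>: "input_at w (int t) = RightEnd" using 2 by (simp add: input_at_def)
    have "\<not> copies q (input_at w (int t))" for q by (simp add: copies_def \<sigma>)
    from mem_next_conf_skip[OF this] 2 \<sigma> show ?thesis
      by (auto simp: branch_def turned_def position_def goes_left_def)
  next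
    case 3
    \<comment> \<open>\<open>i\<close> is the square under the input head and \<open>k\<close> the
      number of letters that the odd branch has copied; the scanned letter is
      \<open>rev w ! k\<close>.\<close>
    define i where "i = 2 * ?n + 2 - t"
    define k where "k = t - (?n + 2)"
    have ik: "1 \<le> i" "i \<le> ?n" "k < ?n" "?n - Suc k = i - 1" "2 * ?n + 2 - Suc t = i - 1" "Suc t - (?n + 2) = k + 1"
        "t - (?n + 2) = k"
      using 3 assms by (auto simp: i_def k_def)
    have \<sigma>: "input_at w (int i) = Letter (w ! (i - 1))"
      using ik by (auto simp: input_at_def nat_diff_distrib)
    have a: "w ! (i - 1) \<in> {0, 1}" using ik by (intro nth_bit letters) simp
    have take: "take (k + 1) (rev w) = take k (rev w) @ [w ! (i - 1)]"
      using ik take_Suc_conv_app_nth[of k "rev w"] by (simp add: rev_nth)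
    have t: "turned t" "turned (Suc t)" "position t = i" "position (Suc t) = i - 1"
      using 3 ik by (auto simp: turned_def position_def i_def)
    show ?thesis
    proof (cases \<beta>)
      case True
      have "copies 3 (input_at w (int i))" by (simp add: copies_def \<sigma>)
      from mem_next_conf_copy[OF this \<sigma> a, of "take k (rev w)" k] True ik take show ?thesis
        by (simp add: branch_def t)
    next
      case False
      have "\<not> copies 2 (input_at w (int i))" by (simp add: copies_def)
      from mem_next_conf_skip[OF this] False 3 \<sigma> show ?thesis
        by (simp add: branch_def t goes_left_def)
    qed
  qed
qed

lemma scanned_not_left_end:
  assumes "1 \<le> t" "t \<le> 2 * length w + 1"
  shows "input_at w (int (position t)) \<noteq> LeftEnd"
  using assms by (auto simp: input_at_def position_def turned_def)

lemma turned_Suc: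
  assumes "1 \<le> t" "t \<le> 2 * length w + 1"
  shows "turned (Suc t) \<longleftrightarrow> turned t \<or> input_at w (int (position t)) = RightEnd"
  using assms by (auto simp: input_at_def position_def turned_def)

lemma step_amp_branch:
  assumes "1 \<le> t" "t \<le> 2 * length w + 1"
  shows "step_amp nonpal_qtm w \<omega> d (branch \<beta> t) =
    (if from_nat \<omega> = observed t \<and> d = branch \<beta> (Suc t) then 1 else 0)"
proof -
  let ?\<sigma> = "input_at w (int (position t))"
  have c: "branch \<beta> t \<in> configs nonpal_qtm w" using assms by (simp add: branch_in_configs)
  have left: "goes_left (state (branch \<beta> t)) ?\<sigma> = turned (Suc t)"
    by (simp add: goes_left_def state_branch turned_Suc[OF assms])
  have odd: "odd (state (branch \<beta> t)) = \<beta>" and ge2: "2 \<le> state (branch \<beta> t) \<longleftrightarrow> turned t"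
    by (auto simp: state_branch)
  have state: "state d < 4 \<and> (2 \<le> state d) = turned (Suc t) \<and> odd (state d) = \<beta> \<longleftrightarrow>
      state d = state (branch \<beta> (Suc t))"
  proof -
    have "state d < 4 \<longleftrightarrow> state d \<in> {0, 1, 2, 3}" by auto
    then show ?thesis unfolding state_branch by (cases "turned (Suc t)"; cases \<beta>) auto
  qed
  have amp: "local_amp (state (branch \<beta> t)) ?\<sigma> q' x =
      (if x = observed t \<and> (2 \<le> q') = turned (Suc t) \<and> odd q' = \<beta> then 1 else 0)" for q' x
    using scanned_not_left_end[OF assms]
    by (cases x) (auto simp: local_amp_def observed_def left odd ge2)
  have iff: "d = branch \<beta> (Suc t) \<longleftrightarrow>
      (state d < 4 \<and> (2 \<le> state d) = turned (Suc t) \<and> odd (state d) = \<beta>) \<and>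
      d = mem_next w (branch \<beta> t) (state d)"
    unfolding state using branch_next[OF assms, of \<beta>] by metis
  have "(if P \<and> Q then if X \<and> S then 1 else 0 else 0) = (if X \<and> (P \<and> S) \<and> Q then 1 else 0 :: complex)"
    for P Q X S by auto
  then show ?thesis
    unfolding step_amp_nonpal[OF c] scanned_branch amp iff .
qed

lemma branch_neq: "branch False t \<noteq> branch True t"
  by (metis state_branch add_left_cancel zero_neq_one)

lemma qtm_state_first:
  "qtm_state nonpal_qtm w [\<omega>] d =
    (if d = branch False 1 \<or> d = branch True 1 then local_amp 0 LeftEnd (state d) (from_nat \<omega>) else 0)"
proof -
  have init: "init_config nonpal_qtm = conf 0 0 0 []"
    by (auto simp: init_config_def conf_def tape_of_def)
  have c: "conf 0 0 0 [] \<in> configs nonpal_qtm w" by (rule conf_in_configs) auto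
  have \<sigma>: "input_at w 0 = LeftEnd" by (simp add: input_at_def)
  have next_eq: "mem_next w (conf 0 0 0 []) q' = conf q' 1 0 []" for q'
    using mem_next_conf_skip[of 0 w 0 0 "[]" q'] by (simp add: copies_def \<sigma> goes_left_def)
  have b: "branch \<beta> 1 = conf (if \<beta> then 1 else 0) 1 0 []" for \<beta>
    by (auto simp: branch_def turned_def position_def)
  have "qtm_state nonpal_qtm w [\<omega>] d = step_amp nonpal_qtm w \<omega> d (conf 0 0 0 [])"
    unfolding qtm_state.simps init by (subst infsum_point[OF c]) auto
  also have "\<dots> = (if state d < 4 \<and> d = conf (state d) 1 0 []
      then local_amp 0 LeftEnd (state d) (from_nat \<omega>) else 0)"
    by (simp add: step_amp_nonpal[OF c] scanned_input_def \<sigma> next_eq)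
  also have "\<dots> = (if d = branch False 1 \<or> d = branch True 1
      then local_amp 0 LeftEnd (state d) (from_nat \<omega>) else 0)"
  proof -
    have "local_amp 0 LeftEnd q' x = 0" if "q' \<noteq> 0" "q' \<noteq> 1" for q' x
      using that by (cases x) (auto simp: local_amp_def goes_left_def)
    moreover have "d = conf (state d) 1 0 [] \<and> (state d = 0 \<or> state d = 1) \<longleftrightarrow>
        d = branch False 1 \<or> d = branch True 1"
      unfolding b by auto
    ultimately show ?thesis
      by (cases "state d = 0 \<or> state d = 1") (auto simp del: One_nat_def)
  qed
  finally show ?thesis .
qed

definition histories_of :: "nat \<Rightarrow> nat list set" where
  "histories_of t = {h. length h = t \<and> set h \<subseteq> continue_syms nonpal_qtm}"

text \<open>Between the two gates both branches move deterministically with the same observations,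
  so one continuing history survives. Its probability is 1/2; the other half was rejected by the
  initial gate.\<close>

lemma qtm_state_running:
  assumes "1 \<le> t" "t \<le> 2 * length w + 2" "h \<in> histories_of t"
  shows "qtm_state nonpal_qtm w h =
    (\<lambda>d. if h = observed_history t \<and> (d = branch False t \<or> d = branch True t) then 1/2 else 0)"
  using assms
proof (induction t arbitrary: h rule: dec_induct)
  case base
  then obtain x where x: "h = [to_nat x]" "x \<in> observations - halting"
    by (auto simp: histories_of_def length_Suc_conv)
  have obs: "observed 0 = (False, LeftEnd, False)"
    by (simp add: observed_def turned_def position_def input_at_def)
  have "local_amp 0 LeftEnd q' x = (if x = (False, LeftEnd, False) then 1/2 else 0)" if "q' < 2" for q'
    using x(2) that by (cases x) (auto simp: local_amp_def goes_left_def halting_def)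
  then show ?case
    unfolding x(1) qtm_state_first by (auto simp: fun_eq_iff obs state_branch turned_def)
next
  case (step t)
  then obtain x :: observation and h' where x: "h = to_nat x # h'" "h' \<in> histories_of t"
    by (auto simp: histories_of_def length_Suc_conv)
  have t: "1 \<le> t" "t \<le> 2 * length w + 1" using step by auto
  have IH: "qtm_state nonpal_qtm w h' =
      (\<lambda>d. if h' = observed_history t \<and> (d = branch False t \<or> d = branch True t) then 1/2 else 0)"
    using step.IH x(2) t by simp
  show ?case
  proof (cases "h' = observed_history t")
    case True
    have eq: "qtm_state nonpal_qtm w h d =
        (step_amp nonpal_qtm w (to_nat x) d (branch False t) + step_amp nonpal_qtm w (to_nat x) d (branch True t)) / 2" for d
      unfolding x(1) using IH True t branch_neq
      by (intro qtm_state_two_points) (auto simp: branch_in_configs)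
    then have "qtm_state nonpal_qtm w h d = (if x = observed t \<and> (d = branch False (Suc t) \<or> d = branch True (Suc t))
        then 1/2 else 0)" for d
      unfolding eq step_amp_branch[OF t] using branch_neq[of "Suc t"] by simp
    then show ?thesis
      using True by (simp add: fun_eq_iff x(1) del: qtm_state.simps)
  next
    case False
    with IH show ?thesis by (simp add: x(1) qtm_state_zero)
  qed
qed

lemma step_amp_end:
  assumes "t = 2 * length w + 2"
  shows "step_amp nonpal_qtm w \<omega> d (branch \<beta> t) =
    (if state d < 4 \<and> d = branch \<beta> t\<lparr>state := state d\<rparr>
     then local_amp (state (branch \<beta> t)) LeftEnd (state d) (from_nat \<omega>) else 0)"
proof -
  have c: "branch \<beta> t \<in> configs nonpal_qtm w" using assms by (simp add: branch_in_configs)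
  have \<sigma>: "scanned_input w (branch \<beta> t) = LeftEnd" "2 \<le> state (branch \<beta> t)"
    unfolding scanned_branch state_branch using assms by (auto simp: input_at_def position_def turned_def)
  then have "mem_next w (branch \<beta> t) q' = branch \<beta> t\<lparr>state := q'\<rparr>" for q'
    by (cases "branch \<beta> t")
      (auto simp: mem_next_def head_move_def goes_left_def mem_move_def flips_def copies_def)
  then show ?thesis
    by (simp add: step_amp_nonpal[OF c] \<sigma>)
qed

text \<open>Both outcomes of the final gate halt, so nothing is left to continue.\<close>

lemma qtm_state_after_end:
  assumes "h \<in> histories_of t" "t > 2 * length w + 2"
  shows "qtm_state nonpal_qtm w h = (\<lambda>_. 0)"
proof -
  have "Suc (2 * length w + 2) \<le> t" using assms by simp
  then show ?thesis
    using assms(1)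
  proof (induction t arbitrary: h rule: dec_induct)
    case base
    let ?t = "2 * length w + 2"
    obtain x h' where x: "h = to_nat x # h'" "x \<in> observations - halting" "h' \<in> histories_of ?t"
      using base by (auto simp: histories_of_def length_Suc_conv)
    have IH: "qtm_state nonpal_qtm w h' =
      (\<lambda>d. if h' = observed_history ?t \<and> (d = branch False ?t \<or> d = branch True ?t) then 1/2 else 0)"
      using x by (intro qtm_state_running) auto
    have "local_amp (state (branch \<beta> ?t)) LeftEnd q' x = 0" for \<beta> q'
      using x(2) by (cases x) (auto simp: local_amp_def state_branch turned_def halting_def)
    then have step0: "step_amp nonpal_qtm w (to_nat x) d (branch \<beta> ?t) = 0" for d \<beta>
      by (simp add: step_amp_end)
    show ?case
    proof (cases "h' = observed_history ?t")
      case True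
      have "qtm_state nonpal_qtm w h d =
          (step_amp nonpal_qtm w (to_nat x) d (branch False ?t) + step_amp nonpal_qtm w (to_nat x) d (branch True ?t)) / 2" for d
        unfolding x(1) using IH True branch_neq
        by (intro qtm_state_two_points) (auto simp: branch_in_configs)
      with step0 show ?thesis by auto
    next
      case False
      with IH show ?thesis by (simp add: x(1) qtm_state_zero)
    qed
  next
    case (step t)
    then obtain x :: observation and h' where "h = to_nat x # h'" "h' \<in> histories_of t"
      by (auto simp: histories_of_def length_Suc_conv)
    with step.IH show ?case by (simp add: qtm_state_zero)
  qed
qed

lemma observed_history_in: "t \<le> 2 * length w + 2 \<Longrightarrow> observed_history t \<in> histories_of t"
proof (induction t)
  case 0
  show ?case by (simp add: histories_of_def)
next
  case (Suc t)
  have "input_at w (int (position t)) \<in> insyms {0, 1}"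
    using nth_bit[OF letters, of "nat (int (position t) - 1)"]
    by (auto simp: input_at_def insyms_def)
  moreover have "\<not> (turned t \<and> input_at w (int (position t)) = LeftEnd)"
    using scanned_not_left_end[of t] Suc.prems by (auto simp: turned_def)
  ultimately have "observed t \<in> observations - halting"
    by (auto simp: observed_def halting_def)
  with Suc show ?case by (simp add: histories_of_def)
qed

text \<open>In outcome \<open>True\<close> of the final gate the branches enter with opposite signs.
  On equal memory contents they cancel; otherwise the four configurations from two branches and two
  new states have amplitudes of modulus 1/4, with squares adding up to 1/4.\<close>

lemma history_prob_accept:
  assumes h: "h \<in> histories_of t"
  shows "history_prob nonpal_qtm w (to_nat (True, LeftEnd, True) # h) =
    (if t = 2 * length w + 2 \<and> h = observed_history t \<and> rev w \<noteq> w then 1/4 else 0)"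
proof -
  let ?acc = "(True, LeftEnd, True) :: observation" and ?N = "2 * length w + 2"
  let ?\<psi> = "qtm_state nonpal_qtm w (to_nat ?acc # h)"
  consider "t = 0" | "1 \<le> t" "t \<le> ?N" "h \<noteq> observed_history t" | "1 \<le> t" "t < ?N" "h = observed_history t"
    | "t > ?N" | "t = ?N" "h = observed_history t" by linarith
  then show ?thesis
  proof cases
    case 1
    then have "h = []" using h by (simp add: histories_of_def)
    then have "?\<psi> = (\<lambda>_. 0)"
      by (auto simp: fun_eq_iff local_amp_def qtm_state_first simp del: qtm_state.simps)
    with 1 show ?thesis by (simp add: history_prob_def)
  next
    case 2
    then have "?\<psi> = (\<lambda>_. 0)" using qtm_state_running[OF 2(1,2) h] by (simp add: qtm_state_zero)
    with 2 show ?thesis by (simp add: history_prob_def del: qtm_state.simps)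
  next
    case 3
    then have t: "1 \<le> t" "t \<le> 2 * length w + 1" by auto
    have \<psi>: "?\<psi> d = (step_amp nonpal_qtm w (to_nat ?acc) d (branch False t) +
        step_amp nonpal_qtm w (to_nat ?acc) d (branch True t)) / 2" for d
      using 3 qtm_state_running[OF _ _ h] branch_neq
      by (intro qtm_state_two_points) (auto simp: branch_in_configs)
    have "?acc \<noteq> observed t" by (simp add: observed_def)
    then have "?\<psi> d = 0" for d
      unfolding \<psi> step_amp_branch[OF t] by simp
    with 3 show ?thesis by (simp add: history_prob_def del: qtm_state.simps)
  next
    case 4
    then have "?\<psi> = (\<lambda>_. 0)" using qtm_state_after_end[OF h] by (simp add: qtm_state_zero)
    with 4 show ?thesis by (simp add: history_prob_def del: qtm_state.simps)
  next
    case 5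
    define n where "n = length w"
    let ?D = "\<lambda>\<beta> q. conf q 0 n (if \<beta> then rev w else w)"
    have b: "branch \<beta> t = ?D \<beta> (if \<beta> then 3 else 2)" for \<beta>
      using 5(1) by (simp add: branch_def turned_def position_def n_def)
    have step: "step_amp nonpal_qtm w (to_nat ?acc) d (branch \<beta> t) =
        (if d \<in> {?D \<beta> 2, ?D \<beta> 3} then (if \<beta> then -1/2 else 1/2) else 0)" for d \<beta>
    proof -
      have D: "branch \<beta> t\<lparr>state := q'\<rparr> = ?D \<beta> q'" for q'
        unfolding b by (simp add: conf_def)
      have amp: "local_amp (state (branch \<beta> t)) LeftEnd q' ?acc =
          (if 2 \<le> q' then (if \<beta> then -1/2 else 1/2) else 0)" for q'
        unfolding b by (simp add: local_amp_def goes_left_def)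
      have iff: "d \<in> {?D \<beta> 2, ?D \<beta> 3} \<longleftrightarrow> (state d < 4 \<and> d = ?D \<beta> (state d)) \<and> 2 \<le> state d"
      proof -
        have "state d < 4 \<and> 2 \<le> state d \<longleftrightarrow> state d = 2 \<or> state d = 3" by linarith
        moreover have "d \<in> {?D \<beta> 2, ?D \<beta> 3} \<longleftrightarrow> (state d = 2 \<or> state d = 3) \<and> d = ?D \<beta> (state d)"
          by (metis conf_simps(1) insert_iff empty_iff)
        ultimately show ?thesis by blast
      qed
      have "(if P then if Q then y else 0 else 0) = (if P \<and> Q then y else 0)" for P Q and y :: complex
        by simp
      then show ?thesis
        unfolding step_amp_end[OF 5(1)] from_nat_to_nat D amp iff .
    qed
    have \<psi>: "?\<psi> d = (step_amp nonpal_qtm w (to_nat ?acc) d (branch False t) +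
        step_amp nonpal_qtm w (to_nat ?acc) d (branch True t)) / 2" for d
      using 5 qtm_state_running[OF _ _ h] branch_neq
      by (intro qtm_state_two_points) (auto simp: branch_in_configs)
    show ?thesis
    proof (cases "rev w = w")
      case True
      then have "?\<psi> d = 0" for d by (simp add: \<psi> step del: qtm_state.simps)
      with True show ?thesis by (simp add: history_prob_def del: qtm_state.simps)
    next
      case False
      have neq: "tape_of w \<noteq> tape_of (rev w)" using False tape_of_inj[of w "rev w"] by auto
      let ?F = "{?D False 2, ?D False 3, ?D True 2, ?D True 3}"
      have "history_prob nonpal_qtm w (to_nat ?acc # h) = (\<Sum>d\<in>?F. (cmod (?\<psi> d))\<^sup>2)"
        unfolding history_prob_def
      proof (rule infsum_finite_support)
        show "?F \<subseteq> configs nonpal_qtm w" using letters by (auto intro!: conf_in_configs)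
      qed (auto simp: \<psi> step simp del: qtm_state.simps)
      also have "\<dots> = 1/4"
        using neq neq[symmetric] by (simp add: \<psi> step power2_eq_square del: qtm_state.simps)
      finally show ?thesis using 5 False by simp
    qed
  qed
qed

text \<open>Acceptance can only occur in step \<open>2 * length w + 3\<close> and after one history,
  so the series and the inner sum have a single term.\<close>

lemma accept_prob_nonpal: "qtm_accept_prob nonpal_qtm w = (if rev w = w then 0 else 1/4)"
proof -
  let ?N = "2 * length w + 2"
  have "finite observations" by (simp add: insyms_def)
  then have "finite (continue_syms nonpal_qtm)"
    unfolding nonpal_qtm_simps by (intro finite_imageI finite_Diff)
  moreover have "histories_of t = {h. set h \<subseteq> continue_syms nonpal_qtm \<and> length h = t}" for t
    unfolding histories_of_def by blast
  ultimately have fin: "finite (histories_of t)" for t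
    by (simp only: finite_lists_length_eq)
  have S: "(\<Sum>h\<in>histories_of t. \<Sum>\<omega>\<in>accept_syms nonpal_qtm. history_prob nonpal_qtm w (\<omega> # h)) =
      (if t = ?N then if rev w = w then 0 else 1/4 else 0)" for t
  proof -
    have "(\<Sum>h\<in>histories_of t. \<Sum>\<omega>\<in>accept_syms nonpal_qtm. history_prob nonpal_qtm w (\<omega> # h)) =
        (\<Sum>h\<in>histories_of t. if h = observed_history t then if t = ?N \<and> rev w \<noteq> w then 1/4 else 0 else 0)"
      by (intro sum.cong refl) (simp add: history_prob_accept)
    also have "\<dots> = (if t = ?N then if rev w = w then 0 else 1/4 else 0)"
      using observed_history_in[of t]
      by (cases "t = ?N") (simp_all add: fin del: observed_history.simps)
    finally show ?thesis .
  qed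
  have "qtm_accept_prob nonpal_qtm w = (\<Sum>t. if t = ?N then if rev w = w then 0 else 1/4 else 0)"
    unfolding qtm_accept_prob_def histories_of_def[symmetric] S ..
  also have "\<dots> = (if rev w = w then 0 else 1/4)"
    using sums_single[of ?N "\<lambda>_. if rev w = w then 0 else 1/4 :: real"] by (rule sums_unique[symmetric])
  finally show ?thesis .
qed

end

theorem nonpalindromes_QTM_WOM: "nonpalindromes \<in> QTM_WOM_pos_one_sided s {0, 1}"
proof -
  have "recognizes_pos_one_sided {0, 1} (qtm_accept_prob nonpal_qtm) nonpalindromes"
    unfolding recognizes_pos_one_sided_def
  proof (intro exI[of _ "1/4"] conjI ballI impI)
    fix w assume w: "w \<in> lists {0::nat, 1}"
    show "qtm_accept_prob nonpal_qtm w \<ge> 1/4" if "w \<in> nonpalindromes"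
      using that by (simp add: accept_prob_nonpal[OF w] nonpalindromes_def)
    show "qtm_accept_prob nonpal_qtm w = 0" if "w \<notin> nonpalindromes"
    proof -
      from that w have "rev w = w" unfolding nonpalindromes_def by blast
      then show ?thesis by (simp add: accept_prob_nonpal[OF w])
    qed
  qed simp_all
  moreover have "nonpalindromes \<subseteq> lists {0, 1}"
    unfolding nonpalindromes_def by blast
  ultimately show ?thesis
    unfolding QTM_WOM_pos_one_sided_def mem_Collect_eq
    by (intro conjI exI[of _ nonpal_qtm] nonpal_qtm_ok nonpal_qtm_space)
qed

theorem corollary4:
  fixes s :: "nat \<Rightarrow> real"
  assumes "s \<in> o(\<lambda>n. ln (real n))"
  shows "(\<forall>\<Sigma>. finite \<Sigma> \<longrightarrow> PTM_WOM_pos_one_sided s \<Sigma> \<subseteq> QTM_WOM_pos_one_sided s \<Sigma>) \<and>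
         (\<exists>\<Sigma>. finite \<Sigma> \<and>
            (\<exists>L. L \<in> QTM_WOM_pos_one_sided s \<Sigma> \<and> L \<notin> PTM_WOM_pos_one_sided s \<Sigma>))"
proof (intro conjI allI impI exI[of _ "{0::nat, 1}"] exI[of _ nonpalindromes])
  show "PTM_WOM_pos_one_sided s \<Sigma> \<subseteq> QTM_WOM_pos_one_sided s \<Sigma>" if "finite \<Sigma>" for \<Sigma>
    using that by (rule PTM_WOM_subset_QTM_WOM)
qed (simp, rule nonpalindromes_QTM_WOM, rule nonpalindromes_not_PTM_WOM[OF assms])

end
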